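(* Let $\mathfrak t$ be a Lie algebroid over $M$, let $\mathfrak g\subset J^1\mathfrak t$ be an infinitesimal geometric structure on $\mathfrak t$, and let $\mathfrak g^{(1)}\subset J^1\mathfrak g$ be its prolongation. Then a section $W$ of $\mathfrak t$ is a symmetry of $\mathfrak g$ if and only if $J^1W$ is a section of $\mathfrak g$ that is a symmetry of $\mathfrak g^{(1)}$.
   Context: Everything is $C^\infty$. For a vector bundle $E$ over $M$, $J^kE$ is the bundle of $k$-jets of sections of $E$, and $J^k\sigma$ the prolongation of a section $\sigma$. If $\mathfrak t$ is a Lie algebroid over $M$, then $J^1\mathfrak t$ is a Lie algebroid with anchor $J^1\mathfrak t\to\mathfrak t\xrightarrow{\#}TM$ and the unique bracket with $[J^1X,J^1Y]=J^1[X,Y]$. An infinitesimal geometric structure on $\mathfrak t$ is a subalgebroid (constant-rank subbundle whose sections are closed under the bracket) $\mathfrak g\subset J^1\mathfrak t$. For any subset $S\subset J^1E$ of the first jet bundle of a vector bundle $E$, a symmetry of $S$ is a section $W$ of $E$ such that $J^1W(m)\in S$ for all $m\in M$. $J^1\mathfrak g$ is regarded as a subbundle of $J^1(J^1\mathfrak t)$, and $J^2\mathfrak t$ is regarded as a subbundle of $J^1(J^1\mathfrak t)$ via the natural inclusion $J^2W(m)\mapsto J^1(J^1W)(m)$. The prolongation of $\mathfrak g$ is the subset $\mathfrak g^{(1)}:=J^1\mathfrak g\cap J^2\mathfrak t\subset J^1\mathfrak g$ (not assumed to have constant rank). *)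

theory Defs
  imports "HOL-Analysis.Analysis"
begin

section \<open>Smooth functions on open subsets of \<open>\<real>\<^sup>n\<close>\<close>

text \<open>
  As in \<^theory>\<open>HOL-Analysis.Abstract_Euclidean_Space\<close>, \<open>\<real>\<^sup>n\<close> is the set of real sequences vanishing
  from index \<open>n\<close> on, with the product topology.  Thus \<open>n\<close> is a term (the rank of a jet bundle is
  computed from \<open>n\<close> and the rank of the bundle), and \<open>n = 0\<close> is allowed.
\<close>

abbreviation Rn :: "nat \<Rightarrow> (nat \<Rightarrow> real) set" where
  "Rn n \<equiv> topspace (Euclidean_space n)"

definition pd :: "nat \<Rightarrow> ((nat \<Rightarrow> real) \<Rightarrow> real) \<Rightarrow> (nat \<Rightarrow> real) \<Rightarrow> real" where
  "pd i f x = deriv (\<lambda>t. f (x(i := t))) (x i)"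

definition pds :: "nat list \<Rightarrow> ((nat \<Rightarrow> real) \<Rightarrow> real) \<Rightarrow> (nat \<Rightarrow> real) \<Rightarrow> real" where
  "pds js f = foldr pd js f"

text \<open>\<open>Ck k n A f\<close>: the function \<open>f\<close> is of class \<open>C\<^sup>k\<close> on the open subset \<open>A\<close> of \<open>\<real>\<^sup>n\<close>.\<close>

primrec Ck :: "nat \<Rightarrow> nat \<Rightarrow> (nat \<Rightarrow> real) set \<Rightarrow> ((nat \<Rightarrow> real) \<Rightarrow> real) \<Rightarrow> bool" where
  "Ck 0 n A f \<longleftrightarrow> continuous_on A f"
| "Ck (Suc k) n A f \<longleftrightarrow> continuous_on A f \<and>
     (\<forall>i<n. (\<forall>x\<in>A. (\<lambda>t. f (x(i := t))) differentiable (at (x i))) \<and> Ck k n A (pd i f))"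

definition Cinf :: "nat \<Rightarrow> (nat \<Rightarrow> real) set \<Rightarrow> ((nat \<Rightarrow> real) \<Rightarrow> real) \<Rightarrow> bool" where
  "Cinf n A f \<longleftrightarrow> (\<forall>k. Ck k n A f)"


section \<open>Smooth manifolds\<close>

text \<open>
  The points of a manifold are the elements of a Hausdorff, second countable type.  A chart is a pair
  of its domain and a map that matters only on that domain.
\<close>

type_synonym 'm chart = "'m set \<times> ('m \<Rightarrow> nat \<Rightarrow> real)"

record 'm manifold =
  mdim :: nat
  charts :: "'m chart set"

definition smooth_manifold :: "'m::{t2_space, second_countable_topology} manifold \<Rightarrow> bool" where
  "smooth_manifold M \<longleftrightarrow>
     (\<forall>x. \<exists>(U, \<phi>)\<in>charts M. x \<in> U) \<and>
     (\<forall>(U, \<phi>)\<in>charts M. open U \<and> openin (Euclidean_space (mdim M)) (\<phi> ` U) \<and>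
        homeomorphism U (\<phi> ` U) \<phi> (inv_into U \<phi>)) \<and>
     (\<forall>(U, \<phi>)\<in>charts M. \<forall>(V, \<psi>)\<in>charts M. \<forall>i<mdim M.
        Cinf (mdim M) (\<phi> ` (U \<inter> V)) (\<lambda>y. \<psi> (inv_into U \<phi> y) i))"

text \<open>Smoothness on an open set \<open>A\<close>; the values outside \<open>A\<close> are irrelevant.\<close>

definition smooth_fun_on ::
  "'m::{t2_space, second_countable_topology} manifold \<Rightarrow> 'm set \<Rightarrow> ('m \<Rightarrow> real) \<Rightarrow> bool" where
  "smooth_fun_on M A f \<longleftrightarrow>
     (\<forall>(U, \<phi>)\<in>charts M. Cinf (mdim M) (\<phi> ` (U \<inter> A)) (\<lambda>y. f (inv_into U \<phi> y)))"

definition smooth_fun_near ::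
  "'m::{t2_space, second_countable_topology} manifold \<Rightarrow> 'm \<Rightarrow> ('m \<Rightarrow> real) \<Rightarrow> bool" where
  "smooth_fun_near M m f \<longleftrightarrow> (\<exists>A. open A \<and> m \<in> A \<and> smooth_fun_on M A f)"


section \<open>Vector bundles\<close>

text \<open>
  A vector bundle is given by its fibres (with their linear structure) and a bundle atlas.  A local
  trivialisation \<open>(U, \<tau>)\<close> is recorded through its fibre coordinates: \<open>\<tau>\<close> restricts to a linear
  isomorphism from the fibre over \<open>x\<close> onto \<open>\<real>\<^sup>r\<close> for each \<open>x \<in> U\<close>.  The topology and the smooth
  structure of the total space are the ones determined by the atlas, and the vector space axioms of
  the fibres follow from the existence of the fibrewise isomorphisms.
\<close>

type_synonym ('m, 'e) triv = "'m set \<times> ('e \<Rightarrow> nat \<Rightarrow> real)"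

record ('m, 'e) vbundle =
  btotal :: "'e set"
  bproj :: "'e \<Rightarrow> 'm"
  badd :: "'e \<Rightarrow> 'e \<Rightarrow> 'e"
  bscale :: "real \<Rightarrow> 'e \<Rightarrow> 'e"
  brank :: nat
  trivs :: "('m, 'e) triv set"

definition fibre :: "('m, 'e, 'z) vbundle_scheme \<Rightarrow> 'm \<Rightarrow> 'e set" where
  "fibre E x = {e \<in> btotal E. bproj E e = x}"

definition local_triv ::
  "('m::{t2_space, second_countable_topology}, 'e, 'z) vbundle_scheme \<Rightarrow> ('m, 'e) triv \<Rightarrow> bool" where
  "local_triv E = (\<lambda>(U, \<tau>). open U \<and>
     (\<forall>x\<in>U. bij_betw \<tau> (fibre E x) (Rn (brank E)) \<and>
        (\<forall>e\<in>fibre E x. \<forall>e'\<in>fibre E x. \<tau> (badd E e e') = (\<lambda>a. \<tau> e a + \<tau> e' a)) \<and>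
        (\<forall>c. \<forall>e\<in>fibre E x. \<tau> (bscale E c e) = (\<lambda>a. c * \<tau> e a))))"

definition smooth_transition ::
  "'m::{t2_space, second_countable_topology} manifold \<Rightarrow> ('m, 'e, 'z) vbundle_scheme \<Rightarrow>
   ('m, 'e) triv \<Rightarrow> ('m, 'e) triv \<Rightarrow> bool" where
  "smooth_transition M E = (\<lambda>(U, \<tau>) (V, \<sigma>). \<forall>v\<in>Rn (brank E). \<forall>a<brank E.
     smooth_fun_on M (U \<inter> V) (\<lambda>x. \<sigma> (inv_into (fibre E x) \<tau> v) a))"

definition vector_bundle ::
  "'m::{t2_space, second_countable_topology} manifold \<Rightarrow> ('m, 'e, 'z) vbundle_scheme \<Rightarrow> bool" where
  "vector_bundle M E \<longleftrightarrow>
     (\<forall>x. \<forall>e\<in>fibre E x. \<forall>e'\<in>fibre E x. badd E e e' \<in> fibre E x) \<and>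
     (\<forall>x. \<forall>c. \<forall>e\<in>fibre E x. bscale E c e \<in> fibre E x) \<and>
     (\<forall>x. \<exists>(U, \<tau>)\<in>trivs E. x \<in> U) \<and>
     (\<forall>T\<in>trivs E. local_triv E T) \<and>
     (\<forall>T\<in>trivs E. \<forall>T'\<in>trivs E. smooth_transition M E T T')"

definition smooth_section_on ::
  "'m::{t2_space, second_countable_topology} manifold \<Rightarrow> ('m, 'e, 'z) vbundle_scheme \<Rightarrow>
   'm set \<Rightarrow> ('m \<Rightarrow> 'e) \<Rightarrow> bool" where
  "smooth_section_on M E A s \<longleftrightarrow>
     (\<forall>x\<in>A. s x \<in> fibre E x) \<and>
     (\<forall>(U, \<tau>)\<in>trivs E. \<forall>a<brank E. smooth_fun_on M (U \<inter> A) (\<lambda>x. \<tau> (s x) a))"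

definition sections ::
  "'m::{t2_space, second_countable_topology} manifold \<Rightarrow> ('m, 'e, 'z) vbundle_scheme \<Rightarrow>
   ('m \<Rightarrow> 'e) set" where
  "sections M E = {s. smooth_section_on M E UNIV s}"

definition local_section ::
  "'m::{t2_space, second_countable_topology} manifold \<Rightarrow> ('m, 'e, 'z) vbundle_scheme \<Rightarrow>
   'm \<Rightarrow> ('m \<Rightarrow> 'e) \<Rightarrow> bool" where
  "local_section M E m s \<longleftrightarrow> (\<exists>A. open A \<and> m \<in> A \<and> smooth_section_on M E A s)"

definition sec_add :: "('m, 'e, 'z) vbundle_scheme \<Rightarrow> ('m \<Rightarrow> 'e) \<Rightarrow> ('m \<Rightarrow> 'e) \<Rightarrow> 'm \<Rightarrow> 'e" where
  "sec_add E s s' = (\<lambda>x. badd E (s x) (s' x))"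

definition sec_scale :: "('m, 'e, 'z) vbundle_scheme \<Rightarrow> ('m \<Rightarrow> real) \<Rightarrow> ('m \<Rightarrow> 'e) \<Rightarrow> 'm \<Rightarrow> 'e" where
  "sec_scale E f s = (\<lambda>x. bscale E (f x) (s x))"

text \<open>Vector bundle morphisms over the identity.\<close>

definition bundle_morphism ::
  "'m::{t2_space, second_countable_topology} manifold \<Rightarrow> ('m, 'e, 'z) vbundle_scheme \<Rightarrow>
   ('m, 'f, 'y) vbundle_scheme \<Rightarrow> ('e \<Rightarrow> 'f) \<Rightarrow> bool" where
  "bundle_morphism M E F h \<longleftrightarrow>
     (\<forall>x. \<forall>e\<in>fibre E x. h e \<in> fibre F x) \<and>
     (\<forall>x. \<forall>e\<in>fibre E x. \<forall>e'\<in>fibre E x. h (badd E e e') = badd F (h e) (h e')) \<and>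
     (\<forall>x. \<forall>c. \<forall>e\<in>fibre E x. h (bscale E c e) = bscale F c (h e)) \<and>
     (\<forall>(U, \<tau>)\<in>trivs E. \<forall>(V, \<sigma>)\<in>trivs F. \<forall>v\<in>Rn (brank E). \<forall>b<brank F.
        smooth_fun_on M (U \<inter> V) (\<lambda>x. \<sigma> (h (inv_into (fibre E x) \<tau> v)) b))"


subsection \<open>Subbundles\<close>

text \<open>
  A subset \<open>S\<close> of the total space is a subbundle of rank \<open>k\<close> if around every point there is a local
  trivialisation of \<open>E\<close>, compatible with the atlas but not necessarily in it, that carries \<open>S\<close> to
  \<open>\<real>\<^sup>k \<times> 0\<close>.  These adapted trivialisations form the bundle atlas of \<open>S\<close>.
\<close>

definition adapted_triv ::
  "'m::{t2_space, second_countable_topology} manifold \<Rightarrow> ('m, 'e, 'z) vbundle_scheme \<Rightarrow>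
   nat \<Rightarrow> 'e set \<Rightarrow> ('m, 'e) triv \<Rightarrow> bool" where
  "adapted_triv M E k S T \<longleftrightarrow>
     local_triv E T \<and> (\<forall>T'\<in>trivs E. smooth_transition M E T T' \<and> smooth_transition M E T' T) \<and>
     (\<forall>x\<in>fst T. \<forall>e\<in>fibre E x. e \<in> S \<longleftrightarrow> snd T e \<in> Rn k)"

definition subbundle_of_rank ::
  "'m::{t2_space, second_countable_topology} manifold \<Rightarrow> ('m, 'e, 'z) vbundle_scheme \<Rightarrow>
   nat \<Rightarrow> 'e set \<Rightarrow> bool" where
  "subbundle_of_rank M E k S \<longleftrightarrow>
     S \<subseteq> btotal E \<and> k \<le> brank E \<and> (\<forall>x. \<exists>T. adapted_triv M E k S T \<and> x \<in> fst T)"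

definition subbundle ::
  "'m::{t2_space, second_countable_topology} manifold \<Rightarrow> ('m, 'e, 'z) vbundle_scheme \<Rightarrow>
   'e set \<Rightarrow> bool" where
  "subbundle M E S \<longleftrightarrow> (\<exists>k. subbundle_of_rank M E k S)"

text \<open>The rank is unique, so the choice in the next definition is harmless.\<close>

definition subbundle_rank ::
  "'m::{t2_space, second_countable_topology} manifold \<Rightarrow> ('m, 'e, 'z) vbundle_scheme \<Rightarrow>
   'e set \<Rightarrow> nat" where
  "subbundle_rank M E S = (SOME k. subbundle_of_rank M E k S)"

definition sub_bundle ::
  "'m::{t2_space, second_countable_topology} manifold \<Rightarrow> ('m, 'e, 'z) vbundle_scheme \<Rightarrow>
   'e set \<Rightarrow> ('m, 'e) vbundle" where
  "sub_bundle M E S =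
     \<lparr>btotal = S, bproj = bproj E, badd = badd E, bscale = bscale E,
      brank = subbundle_rank M E S,
      trivs = {T. adapted_triv M E (subbundle_rank M E S) S T}\<rparr>"


subsection \<open>The tangent bundle\<close>

text \<open>
  Tangent vectors at \<open>m\<close> are the derivations at \<open>m\<close> of the functions that are smooth near \<open>m\<close>, made
  into total functions by the value 0 on all other functions.  Such a derivation depends on the germ
  only: if \<open>f\<close> vanishes near \<open>m\<close>, apply the Leibniz rule to \<open>f = f * h\<close>, where \<open>h\<close> is 0 near \<open>m\<close> and
  1 wherever \<open>f\<close> is nonzero.
\<close>

type_synonym 'm tangent = "'m \<times> (('m \<Rightarrow> real) \<Rightarrow> real)"

definition derivation_at ::
  "'m::{t2_space, second_countable_topology} manifold \<Rightarrow> 'm \<Rightarrow> (('m \<Rightarrow> real) \<Rightarrow> real) \<Rightarrow> bool" where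
  "derivation_at M m D \<longleftrightarrow>
     (\<forall>f. \<not> smooth_fun_near M m f \<longrightarrow> D f = 0) \<and>
     (\<forall>f g. smooth_fun_near M m f \<and> smooth_fun_near M m g \<longrightarrow>
        D (\<lambda>x. f x + g x) = D f + D g \<and> D (\<lambda>x. f x * g x) = f m * D g + g m * D f) \<and>
     (\<forall>c f. smooth_fun_near M m f \<longrightarrow> D (\<lambda>x. c * f x) = c * D f)"

definition tangent_bundle ::
  "'m::{t2_space, second_countable_topology} manifold \<Rightarrow> ('m, 'm tangent) vbundle" where
  "tangent_bundle M =
     \<lparr>btotal = {(m, D). derivation_at M m D}, bproj = fst,
      badd = (\<lambda>v w. (fst v, \<lambda>f. snd v f + snd w f)),
      bscale = (\<lambda>c v. (fst v, \<lambda>f. c * snd v f)),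
      brank = mdim M,
      trivs = {(U, \<lambda>v i. if i < mdim M then snd v (\<lambda>x. \<phi> x i) else 0) | U \<phi>. (U, \<phi>) \<in> charts M}\<rparr>"


section \<open>Jets\<close>

text \<open>
  A \<open>k\<close>-jet of sections of \<open>E\<close> is a pair of its base point \<open>m\<close> and an equivalence class of sections
  defined and smooth near \<open>m\<close>, two of them being equivalent if their partial derivatives at \<open>m\<close> up to
  order \<open>k\<close> agree in coordinates.
\<close>

type_synonym ('m, 'e) jet = "'m \<times> ('m \<Rightarrow> 'e) set"

definition same_jet ::
  "'m::{t2_space, second_countable_topology} manifold \<Rightarrow> ('m, 'e, 'z) vbundle_scheme \<Rightarrow>
   nat \<Rightarrow> 'm \<Rightarrow> ('m \<Rightarrow> 'e) \<Rightarrow> ('m \<Rightarrow> 'e) \<Rightarrow> bool" where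
  "same_jet M E k m s s' \<longleftrightarrow>
     (\<forall>(U, \<phi>)\<in>charts M. \<forall>(V, \<tau>)\<in>trivs E. m \<in> U \<inter> V \<longrightarrow>
        (\<forall>a<brank E. \<forall>js\<in>lists {..<mdim M}. length js \<le> k \<longrightarrow>
           pds js (\<lambda>y. \<tau> (s (inv_into U \<phi> y)) a) (\<phi> m) =
           pds js (\<lambda>y. \<tau> (s' (inv_into U \<phi> y)) a) (\<phi> m)))"

definition jet ::
  "'m::{t2_space, second_countable_topology} manifold \<Rightarrow> ('m, 'e, 'z) vbundle_scheme \<Rightarrow>
   nat \<Rightarrow> ('m \<Rightarrow> 'e) \<Rightarrow> 'm \<Rightarrow> ('m, 'e) jet" where
  "jet M E k s m = (m, {s'. local_section M E m s' \<and> same_jet M E k m s s'})"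

definition jets ::
  "'m::{t2_space, second_countable_topology} manifold \<Rightarrow> ('m, 'e, 'z) vbundle_scheme \<Rightarrow>
   nat \<Rightarrow> ('m, 'e) jet set" where
  "jets M E k = {jet M E k s m | s m. local_section M E m s}"

definition jet_rep :: "('m, 'e) jet \<Rightarrow> 'm \<Rightarrow> 'e" where
  "jet_rep \<xi> = (SOME s. s \<in> snd \<xi>)"

text \<open>
  Fibre coordinates on \<open>J\<^sup>1E\<close> induced by a chart \<open>(U, \<phi>)\<close> and a local trivialisation \<open>\<tau>\<close>.  With
  \<open>r\<close> the rank of \<open>E\<close> and \<open>a < r\<close>, the coordinate of index \<open>a\<close> is the \<open>a\<close>-th component of the section,
  and the one of index \<open>(j + 1) * r + a\<close> is the \<open>j\<close>-th partial derivative of that component.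
\<close>

definition J1_coord ::
  "'m::{t2_space, second_countable_topology} manifold \<Rightarrow> ('m, 'e, 'z) vbundle_scheme \<Rightarrow>
   'm chart \<Rightarrow> ('e \<Rightarrow> nat \<Rightarrow> real) \<Rightarrow> ('m, 'e) jet \<Rightarrow> nat \<Rightarrow> real" where
  "J1_coord M E = (\<lambda>(U, \<phi>) \<tau> \<xi> b.
     let r = brank E; l = b div r;
         f = (\<lambda>y. \<tau> (jet_rep \<xi> (inv_into U \<phi> y)) (b mod r))
     in if b < (mdim M + 1) * r
        then pds (if l = 0 then [] else [l - 1]) f (\<phi> (fst \<xi>)) else 0)"

definition J1 ::
  "'m::{t2_space, second_countable_topology} manifold \<Rightarrow> ('m, 'e, 'z) vbundle_scheme \<Rightarrow>
   ('m, ('m, 'e) jet) vbundle" where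
  "J1 M E =
     \<lparr>btotal = jets M E 1, bproj = fst,
      badd = (\<lambda>\<xi> \<eta>. jet M E 1 (sec_add E (jet_rep \<xi>) (jet_rep \<eta>)) (fst \<xi>)),
      bscale = (\<lambda>c \<xi>. jet M E 1 (sec_scale E (\<lambda>_. c) (jet_rep \<xi>)) (fst \<xi>)),
      brank = (mdim M + 1) * brank E,
      trivs = {(U \<inter> V, J1_coord M E (U, \<phi>) \<tau>) | U \<phi> V \<tau>. (U, \<phi>) \<in> charts M \<and> (V, \<tau>) \<in> trivs E}\<rparr>"

text \<open>The inclusion \<open>J\<^sup>2E \<rightarrow> J\<^sup>1(J\<^sup>1E)\<close>, \<open>J\<^sup>2W(m) \<mapsto> J\<^sup>1(J\<^sup>1W)(m)\<close>.\<close>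

definition J2_inclusion ::
  "'m::{t2_space, second_countable_topology} manifold \<Rightarrow> ('m, 'e, 'z) vbundle_scheme \<Rightarrow>
   ('m, 'e) jet \<Rightarrow> ('m, ('m, 'e) jet) jet" where
  "J2_inclusion M E \<xi> = jet M (J1 M E) 1 (jet M E 1 (jet_rep \<xi>)) (fst \<xi>)"

text \<open>The inclusion \<open>J\<^sup>1F \<rightarrow> J\<^sup>1E\<close> for a subbundle \<open>F\<close> of \<open>E\<close>: regard a section of \<open>F\<close> as one of \<open>E\<close>.\<close>

definition J1_sub_inclusion ::
  "'m::{t2_space, second_countable_topology} manifold \<Rightarrow> ('m, 'e, 'z) vbundle_scheme \<Rightarrow>
   ('m, 'e) jet \<Rightarrow> ('m, 'e) jet" where
  "J1_sub_inclusion M E \<xi> = jet M E 1 (jet_rep \<xi>) (fst \<xi>)"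

definition is_symmetry ::
  "'m::{t2_space, second_countable_topology} manifold \<Rightarrow> ('m, 'e, 'z) vbundle_scheme \<Rightarrow>
   ('m, 'e) jet set \<Rightarrow> ('m \<Rightarrow> 'e) \<Rightarrow> bool" where
  "is_symmetry M E S W \<longleftrightarrow> W \<in> sections M E \<and> (\<forall>m. jet M E 1 W m \<in> S)"


section \<open>Lie algebroids\<close>

record ('m, 'e) algebroid = "('m, 'e) vbundle" +
  anchor :: "'e \<Rightarrow> 'm tangent"
  bracket :: "('m \<Rightarrow> 'e) \<Rightarrow> ('m \<Rightarrow> 'e) \<Rightarrow> 'm \<Rightarrow> 'e"

text \<open>
  The bracket is only relevant on smooth sections.  That the anchor maps brackets to brackets of vector
  fields is a consequence of the Jacobi identity and the Leibniz rule.
\<close>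

definition lie_algebroid ::
  "'m::{t2_space, second_countable_topology} manifold \<Rightarrow> ('m, 'e, 'z) algebroid_scheme \<Rightarrow> bool" where
  "lie_algebroid M A \<longleftrightarrow>
     vector_bundle M A \<and> bundle_morphism M A (tangent_bundle M) (anchor A) \<and>
     (\<forall>X\<in>sections M A. \<forall>Y\<in>sections M A.
        bracket A X Y \<in> sections M A \<and>
        bracket A Y X = sec_scale A (\<lambda>_. - 1) (bracket A X Y) \<and>
        (\<forall>c. bracket A X (sec_scale A (\<lambda>_. c) Y) = sec_scale A (\<lambda>_. c) (bracket A X Y)) \<and>
        (\<forall>f. smooth_fun_on M UNIV f \<longrightarrow>
           bracket A X (sec_scale A f Y) =
           sec_add A (sec_scale A f (bracket A X Y)) (sec_scale A (\<lambda>m. snd (anchor A (X m)) f) Y)) \<and>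
        (\<forall>Z\<in>sections M A.
           bracket A X (sec_add A Y Z) = sec_add A (bracket A X Y) (bracket A X Z) \<and>
           bracket A X (bracket A Y Z) =
           sec_add A (bracket A (bracket A X Y) Z) (bracket A Y (bracket A X Z))))"

definition subalgebroid ::
  "'m::{t2_space, second_countable_topology} manifold \<Rightarrow> ('m, 'e, 'z) algebroid_scheme \<Rightarrow>
   'e set \<Rightarrow> bool" where
  "subalgebroid M A S \<longleftrightarrow>
     subbundle M A S \<and>
     (\<forall>X\<in>sections M (sub_bundle M A S). \<forall>Y\<in>sections M (sub_bundle M A S).
        bracket A X Y \<in> sections M (sub_bundle M A S))"

definition J1_with ::
  "'m::{t2_space, second_countable_topology} manifold \<Rightarrow> ('m, 'e, 'z) algebroid_scheme \<Rightarrow>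
   (('m \<Rightarrow> ('m, 'e) jet) \<Rightarrow> ('m \<Rightarrow> ('m, 'e) jet) \<Rightarrow> 'm \<Rightarrow> ('m, 'e) jet) \<Rightarrow>
   ('m, ('m, 'e) jet) algebroid" where
  "J1_with M A br =
     vbundle.extend (J1 M A) (algebroid.fields (\<lambda>\<xi>. anchor A (jet_rep \<xi> (fst \<xi>))) br)"

text \<open>
  The bracket of \<open>J\<^sup>1A\<close> is unique as a map on smooth sections; the last condition normalises its values
  elsewhere.
\<close>

definition J1_algebroid ::
  "'m::{t2_space, second_countable_topology} manifold \<Rightarrow> ('m, 'e, 'z) algebroid_scheme \<Rightarrow>
   ('m, ('m, 'e) jet) algebroid" where
  "J1_algebroid M A = J1_with M A (THE br.
     lie_algebroid M (J1_with M A br) \<and>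
     (\<forall>X\<in>sections M A. \<forall>Y\<in>sections M A.
        br (jet M A 1 X) (jet M A 1 Y) = jet M A 1 (bracket A X Y)) \<and>
     (\<forall>X Y. X \<notin> sections M (J1 M A) \<or> Y \<notin> sections M (J1 M A) \<longrightarrow> br X Y = undefined))"


section \<open>Infinitesimal geometric structures\<close>

definition inf_geometric_structure ::
  "'m::{t2_space, second_countable_topology} manifold \<Rightarrow> ('m, 'e, 'z) algebroid_scheme \<Rightarrow>
   ('m, 'e) jet set \<Rightarrow> bool" where
  "inf_geometric_structure M A g \<longleftrightarrow> subalgebroid M (J1_algebroid M A) g"

definition prolongation ::
  "'m::{t2_space, second_countable_topology} manifold \<Rightarrow> ('m, 'e, 'z) algebroid_scheme \<Rightarrow>
   ('m, 'e) jet set \<Rightarrow> ('m, ('m, 'e) jet) jet set" where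
  "prolongation M A g =
     {\<xi> \<in> jets M (sub_bundle M (J1 M A) g) 1.
        J1_sub_inclusion M (J1 M A) \<xi> \<in> J2_inclusion M A ` jets M A 2}"

end

theory Submission
  imports Defs
begin

text \<open>
  Write \<open>\<sigma> = J\<^sup>1W\<close>.  If \<open>\<sigma>\<close> is a section of \<open>g\<close>, then in particular \<open>\<sigma>(m) \<in> g\<close> for all \<open>m\<close>, and \<open>W\<close> is
  a symmetry of \<open>g\<close>.  Conversely, if \<open>\<sigma>(m) \<in> g\<close> for all \<open>m\<close>, then \<open>\<sigma>\<close> is a section of \<open>g\<close>, so that
  \<open>J\<^sup>1\<sigma>(m)\<close> lies in \<open>J\<^sup>1g\<close>; and \<open>J\<^sup>1\<sigma>(m) = J\<^sup>1(J\<^sup>1W)(m)\<close> is the image of \<open>J\<^sup>2W(m)\<close>, so that it lies in \<open>J\<^sup>2t\<close>.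

  The work is to see that these identifications respect the definitions by equivalence classes and
  coordinates.  Three points carry the proof.

  First, \<open>\<sigma>\<close> has to be smooth in the trivialisations adapted to \<open>g\<close> (\<open>prolongation_in_sub_bundle\<close>).
  In the trivialisation of \<open>J\<^sup>1t\<close> induced by a chart and a trivialisation of \<open>t\<close>, its coordinates are
  partial derivatives of the coordinates of \<open>W\<close>, hence smooth in that same chart; an adapted
  trivialisation is a smooth linear image of this one.  For the latter one needs that the induced
  coordinates are linear isomorphisms on the fibres of \<open>J\<^sup>1t\<close> (\<open>local_triv_J1\<close>).

  Second, the class \<open>J\<^sup>1\<sigma>(m)\<close> formed in \<open>g\<close> consists of sections with the same 1-jet in adapted
  coordinates, and these have the same 1-jet in the coordinates of \<open>J\<^sup>1t\<close>, by linearity and the product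
  rule (\<open>same_jet_in_ambient_bundle\<close>).

  Third, sections with the same 2-jet have prolongations with the same 1-jet
  (\<open>same_jet_prolongation\<close>).  The fibre coordinates of \<open>J\<^sup>1t\<close> differentiate in one chart while the outer
  1-jet may be taken in another one, so this rests on the chain rule (\<open>pd_change_of_chart\<close>).
\<close>

section \<open>The chain rule on open subsets of \<open>\<real>\<^sup>n\<close>\<close>

lemma Euclidean_space_top_of_set: "Euclidean_space n = top_of_set {x. \<forall>i\<ge>n. x i = 0}"
  unfolding Euclidean_space_def by (simp add: euclidean_product_topology)

lemma tendsto_coordinatewise:
  fixes c :: "'a \<Rightarrow> 'i \<Rightarrow> real"
  assumes "\<And>i. ((\<lambda>t. c t i) \<longlongrightarrow> p i) F"
  shows "(c \<longlongrightarrow> p) F"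
proof -
  have "limitin (product_topology (\<lambda>i. euclideanreal) UNIV) c p F"
    using assms by (simp add: limitin_componentwise)
  then show ?thesis by (simp add: euclidean_product_topology)
qed

text \<open>
  The coordinates from \<open>n\<close> on are held at their values in \<open>p\<close>, so only the conditions on finitely many
  coordinates remain, and a common \<open>e\<close> serves them all.
\<close>

lemma open_contains_box:
  fixes p :: "nat \<Rightarrow> real"
  assumes "open S" "p \<in> S"
  obtains e where "e > 0" "\<And>y. (\<And>i. i < n \<Longrightarrow> \<bar>y i - p i\<bar> < e) \<Longrightarrow> (\<And>i. i \<ge> n \<Longrightarrow> y i = p i) \<Longrightarrow> y \<in> S"
proof -
  have "openin (product_topology (\<lambda>i. euclidean) UNIV) S"
    using assms(1) by (simp add: euclidean_product_topology)
  then have "\<exists>U. finite {i. U i \<noteq> (UNIV :: real set)} \<and> (\<forall>i. open (U i)) \<and>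
      p \<in> Pi\<^sub>E UNIV U \<and> Pi\<^sub>E UNIV U \<subseteq> S"
    using assms(2) unfolding openin_product_topology_alt by simp
  then obtain U where U: "\<And>i. open (U i)" "p \<in> Pi\<^sub>E UNIV U" "Pi\<^sub>E UNIV U \<subseteq> S" by blast
  have "\<exists>e>0. \<forall>y. \<bar>y - p i\<bar> < e \<longrightarrow> y \<in> U i" for i
  proof -
    have "p i \<in> U i" using U(2) by (auto simp: PiE_def)
    then obtain e where "e > 0" "ball (p i) e \<subseteq> U i" using U(1) open_contains_ball by blast
    then show ?thesis by (intro exI[of _ e]) (auto simp: dist_real_def subset_iff abs_minus_commute)
  qed
  then obtain e where e: "\<And>i. e i > 0" "\<And>i y. \<bar>y - p i\<bar> < e i \<Longrightarrow> y \<in> U i" by metis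
  define d where "d = Min (insert 1 (e ` {..<n}))"
  have d: "d > 0" "\<And>i. i < n \<Longrightarrow> d \<le> e i" using e(1) by (auto simp: d_def)
  show ?thesis
  proof (rule that[OF d(1)])
    fix y assume y: "\<And>i. i < n \<Longrightarrow> \<bar>y i - p i\<bar> < d" "\<And>i. i \<ge> n \<Longrightarrow> y i = p i"
    have "y i \<in> U i" for i
    proof (rule e(2))
      show "\<bar>y i - p i\<bar> < e i"
        using y(1)[of i] y(2)[of i] d(2)[of i] e(1)[of i] by (cases "i < n") auto
    qed
    then show "y \<in> S" using U(3) by (auto simp: PiE_def)
  qed
qed

lemma openin_Euclidean_contains_box:
  assumes "openin (Euclidean_space n) A" "p \<in> A"
  obtains e where "e > 0" "\<And>y. y \<in> Rn n \<Longrightarrow> (\<And>i. i < n \<Longrightarrow> \<bar>y i - p i\<bar> < e) \<Longrightarrow> y \<in> A"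
proof -
  obtain S where S: "open S" "A = Rn n \<inter> S"
    using assms(1) by (auto simp: Euclidean_space_top_of_set openin_open topspace_Euclidean_space)
  obtain e where "e > 0"
    and e: "\<And>y. (\<And>i. i < n \<Longrightarrow> \<bar>y i - p i\<bar> < e) \<Longrightarrow> (\<And>i. i \<ge> n \<Longrightarrow> y i = p i) \<Longrightarrow> y \<in> S"
    using open_contains_box[OF S(1), of p n] S(2) assms(2) by blast
  have "p \<in> Rn n" using S assms(2) by blast
  then have "y \<in> A" if "y \<in> Rn n" "\<And>i. i < n \<Longrightarrow> \<bar>y i - p i\<bar> < e" for y
    using e[of y] that S(2) by (auto simp: topspace_Euclidean_space)
  then show ?thesis using \<open>e > 0\<close> that by blast
qed

lemma Rn_fun_upd: "p \<in> Rn n \<Longrightarrow> i < n \<Longrightarrow> p(i := t) \<in> Rn n"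
  by (auto simp: topspace_Euclidean_space)

lemma openin_Euclidean_subset_Rn: "openin (Euclidean_space n) A \<Longrightarrow> p \<in> A \<Longrightarrow> p \<in> Rn n"
  using openin_subset by blast

lemma eventually_curve_in_open:
  assumes A: "openin (Euclidean_space n) A" "p \<in> A"
    and c: "\<And>i. i < n \<Longrightarrow> ((\<lambda>t. c t i) \<longlongrightarrow> p i) F" "\<forall>\<^sub>F t in F. c t \<in> Rn n"
  shows "\<forall>\<^sub>F t in F. c t \<in> A"
proof -
  obtain e where e: "e > 0" "\<And>y. y \<in> Rn n \<Longrightarrow> (\<And>i. i < n \<Longrightarrow> \<bar>y i - p i\<bar> < e) \<Longrightarrow> y \<in> A"
    using openin_Euclidean_contains_box[OF A] by blast
  have "\<forall>\<^sub>F t in F. \<forall>i\<in>{..<n}. \<bar>c t i - p i\<bar> < e"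
    using c(1) e(1) by (intro eventually_ball_finite) (auto simp: tendsto_iff dist_real_def)
  with c(2) show ?thesis by eventually_elim (use e(2) in auto)
qed

lemma eventually_fun_upd_in_open:
  assumes "openin (Euclidean_space n) A" "p \<in> A" "i < n"
  shows "\<forall>\<^sub>F t in nhds (p i). p(i := t) \<in> A"
proof (rule eventually_curve_in_open[OF assms(1,2)])
  show "((\<lambda>t. (p(i := t)) j) \<longlongrightarrow> p j) (nhds (p i))" if "j < n" for j
    by (cases "j = i") (auto simp: tendsto_ident_at filterlim_ident)
  show "\<forall>\<^sub>F t in nhds (p i). p(i := t) \<in> Rn n"
    using openin_Euclidean_subset_Rn[OF assms(1,2)] assms(3) Rn_fun_upd by auto
qed

text \<open>
  The hypothesis is symmetric in the position of \<open>b\<close> relative to \<open>a\<close>, so that the increment of a curve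
  need not have a known sign.
\<close>

lemma mean_value_segment:
  fixes g g' :: "real \<Rightarrow> real"
  assumes "\<And>u. \<bar>u - a\<bar> \<le> \<bar>b - a\<bar> \<Longrightarrow> (g has_real_derivative g' u) (at u)"
  obtains \<xi> where "\<bar>\<xi> - a\<bar> \<le> \<bar>b - a\<bar>" "g b - g a = g' \<xi> * (b - a)"
proof -
  consider "a = b" | "a < b" | "b < a" by linarith
  then show ?thesis
  proof cases
    case 1 then show ?thesis using that[of a] by simp
  next
    case 2
    obtain z where "a < z" "z < b" "g b - g a = (b - a) * g' z"
      using MVT2[OF 2, of g g'] assms by force
    then show ?thesis using that[of z] by (simp add: mult.commute)
  next
    case 3
    obtain z where "b < z" "z < a" "g a - g b = (a - b) * g' z"
      using MVT2[OF 3, of g g'] assms by force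
    then show ?thesis using that[of z] by (simp add: algebra_simps)
  qed
qed

lemma has_derivative_pd:
  "(\<lambda>t. f (x(i := t))) differentiable (at (x i)) \<Longrightarrow>
   ((\<lambda>t. f (x(i := t))) has_real_derivative pd i f x) (at (x i))"
  unfolding pd_def by (simp add: DERIV_deriv_iff_real_differentiable)

lemma Ck1_has_derivative_pd:
  assumes "Ck 1 n A f" "x \<in> A" "i < n"
  shows "((\<lambda>t. f (x(i := t))) has_real_derivative pd i f x) (at (x i))"
  using assms has_derivative_pd[of f x i] by simp

text \<open>
  The increment of \<open>f\<close> along the curve is split by letting the coordinates move one at a time.  By the
  mean value theorem the contribution of coordinate \<open>k\<close> is a value of \<open>pd k f\<close> near \<open>p\<close> times the
  increment of that coordinate, and \<open>pd k f\<close> is continuous at \<open>p\<close>.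
\<close>

lemma chain_rule_C1:
  assumes A: "openin (Euclidean_space n) A" and f: "Ck 1 n A f"
    and p: "c t0 \<in> A" "\<forall>\<^sub>F t in at t0. c t \<in> Rn n"
    and d: "\<And>i. i < n \<Longrightarrow> ((\<lambda>t. c t i) has_real_derivative d i) (at t0)"
  shows "((\<lambda>t. f (c t)) has_real_derivative (\<Sum>i<n. pd i f (c t0) * d i)) (at t0)"
proof -
  define p where "p = c t0"
  \<comment> \<open>the curve with only its first \<open>k\<close> coordinates moving\<close>
  define cut where "cut k t = (\<lambda>i. if i < k then c t i else p i)" for k t
  have pA: "p \<in> A" using p p_def by simp
  have pR: "p \<in> Rn n" using openin_Euclidean_subset_Rn[OF A pA] .
  obtain e where e: "e > 0" "\<And>y. y \<in> Rn n \<Longrightarrow> (\<And>i. i < n \<Longrightarrow> \<bar>y i - p i\<bar> < e) \<Longrightarrow> y \<in> A"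
    using openin_Euclidean_contains_box[OF A pA] by blast
  have lim: "((\<lambda>t. c t i) \<longlongrightarrow> p i) (at t0)" if "i < n" for i
    using DERIV_isCont[OF d[OF that]] by (simp add: isCont_def p_def)
  have near: "\<forall>\<^sub>F t in at t0. \<forall>i\<in>{..<n}. \<bar>c t i - p i\<bar> < e"
    using lim e(1) by (intro eventually_ball_finite) (auto simp: tendsto_iff dist_real_def)
  have step: "((\<lambda>t. f (cut (Suc k) t) - f (cut k t)) has_real_derivative pd k f p * d k) (at t0)"
    if k: "k < n" for k
  proof -
    have cutR: "cut k t \<in> Rn n" for t
      using pR k by (auto simp: cut_def topspace_Euclidean_space)
    have "\<exists>\<xi>. \<bar>\<xi> - p k\<bar> \<le> \<bar>c t k - p k\<bar> \<and> ((\<forall>i\<in>{..<n}. \<bar>c t i - p i\<bar> < e) \<longrightarrow>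
        f (cut (Suc k) t) - f (cut k t) = pd k f ((cut k t)(k := \<xi>)) * (c t k - p k) \<and>
        (cut k t)(k := \<xi>) \<in> A)" for t
    proof (cases "\<forall>i\<in>{..<n}. \<bar>c t i - p i\<bar> < e")
      case True
      have inA: "(cut k t)(k := u) \<in> A" if "\<bar>u - p k\<bar> \<le> \<bar>c t k - p k\<bar>" for u
      proof (rule e(2))
        show "(cut k t)(k := u) \<in> Rn n" using Rn_fun_upd[OF cutR k] .
        show "\<bar>((cut k t)(k := u)) i - p i\<bar> < e" if "i < n" for i
          using True \<open>i < n\<close> \<open>\<bar>u - p k\<bar> \<le> _\<close> e(1) k by (fastforce simp: cut_def)
      qed
      have "((\<lambda>u. f ((cut k t)(k := u))) has_real_derivative pd k f ((cut k t)(k := u))) (at u)"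
        if "\<bar>u - p k\<bar> \<le> \<bar>c t k - p k\<bar>" for u
        using Ck1_has_derivative_pd[OF f inA[OF that] k] by simp
      then obtain \<xi> where \<xi>: "\<bar>\<xi> - p k\<bar> \<le> \<bar>c t k - p k\<bar>"
        "f ((cut k t)(k := c t k)) - f ((cut k t)(k := p k)) = pd k f ((cut k t)(k := \<xi>)) * (c t k - p k)"
        by (rule mean_value_segment)
      moreover have "(cut k t)(k := c t k) = cut (Suc k) t" "(cut k t)(k := p k) = cut k t"
        by (auto simp: cut_def fun_eq_iff)
      ultimately show ?thesis using inA by metis
    qed auto
    \<comment> \<open>only the distance of \<open>\<xi> t\<close> from \<open>p k\<close> matters; it forces the intermediate points to tend to \<open>p\<close>\<close>
    then obtain \<xi> where \<xi>: "\<And>t. \<bar>\<xi> t - p k\<bar> \<le> \<bar>c t k - p k\<bar>"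
      and eq: "\<And>t. (\<forall>i\<in>{..<n}. \<bar>c t i - p i\<bar> < e) \<Longrightarrow>
        f (cut (Suc k) t) - f (cut k t) = pd k f ((cut k t)(k := \<xi> t)) * (c t k - p k) \<and>
        (cut k t)(k := \<xi> t) \<in> A" by metis
    have "((\<lambda>t. \<xi> t - p k) \<longlongrightarrow> 0) (at t0)"
      by (rule Lim_null_comparison[of _ "\<lambda>t. \<bar>c t k - p k\<bar>"])
        (use \<xi> lim[OF k] in \<open>auto simp: LIM_zero_iff tendsto_rabs_zero_iff\<close>)
    then have \<xi>lim: "(\<xi> \<longlongrightarrow> p k) (at t0)" by (simp add: LIM_zero_iff)
    have "((\<lambda>t. (cut k t)(k := \<xi> t)) \<longlongrightarrow> p) (at t0)"
    proof (rule tendsto_coordinatewise)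
      show "((\<lambda>t. ((cut k t)(k := \<xi> t)) i) \<longlongrightarrow> p i) (at t0)" for i
        using \<xi>lim lim[of i] k by (cases "i = k"; cases "i < k") (auto simp: cut_def)
    qed
    moreover have "continuous_on A (pd k f)" using f k by simp
    moreover have inA: "\<forall>\<^sub>F t in at t0. (cut k t)(k := \<xi> t) \<in> A"
      using near by eventually_elim (use eq in blast)
    ultimately have "((\<lambda>t. pd k f ((cut k t)(k := \<xi> t))) \<longlongrightarrow> pd k f p) (at t0)"
      using pA continuous_on_tendsto_compose by blast
    then have "((\<lambda>t. pd k f ((cut k t)(k := \<xi> t)) * ((c t k - c t0 k) / (t - t0)))
        \<longlongrightarrow> pd k f p * d k) (at t0)"
      using d[OF k] by (intro tendsto_mult) (simp_all add: has_field_derivative_iff)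
    moreover have "\<forall>\<^sub>F t in at t0.
        pd k f ((cut k t)(k := \<xi> t)) * ((c t k - c t0 k) / (t - t0)) =
        ((f (cut (Suc k) t) - f (cut k t)) - (f (cut (Suc k) t0) - f (cut k t0))) / (t - t0)"
      using near
    proof eventually_elim
      case (elim t)
      have "cut (Suc k) t0 = cut k t0" by (auto simp: cut_def p_def)
      then show ?case using eq[OF elim] by (simp add: p_def)
    qed
    ultimately show ?thesis
      unfolding has_field_derivative_iff by (rule Lim_transform_eventually)
  qed
  have "((\<lambda>t. f (cut k t)) has_real_derivative (\<Sum>i<k. pd i f p * d i)) (at t0)" if "k \<le> n" for k
    using that
  proof (induction k)
    case 0
    have "cut 0 = (\<lambda>t. p)" by (auto simp: cut_def)
    then show ?case by simp
  next
    case (Suc k)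
    then show ?case using DERIV_add[OF Suc.IH step[of k]] by simp
  qed
  then have "((\<lambda>t. f (cut n t)) has_real_derivative (\<Sum>i<n. pd i f p * d i)) (at t0)" by simp
  moreover have "\<forall>\<^sub>F t in at t0. f (cut n t) = f (c t)"
    using p(2)
  proof eventually_elim
    case (elim t)
    then have "cut n t = c t" using pR by (auto simp: cut_def topspace_Euclidean_space fun_eq_iff)
    then show ?case by simp
  qed
  moreover have "cut n t0 = c t0" by (auto simp: cut_def p_def fun_eq_iff)
  ultimately show ?thesis
    unfolding p_def
    by (subst has_field_derivative_cong_eventually[where g = "\<lambda>t. f (cut n t)"])
      (auto elim: eventually_mono)
qed

section \<open>Sums, products and locality of smooth functions\<close>

lemma pd_cong:
  assumes "openin (Euclidean_space n) A" "x \<in> A" "i < n" "\<And>y. y \<in> A \<Longrightarrow> f y = g y"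
  shows "pd i f x = pd i g x"
  unfolding pd_def
proof (rule deriv_cong_ev)
  show "\<forall>\<^sub>F t in nhds (x i). f (x(i := t)) = g (x(i := t))"
    using eventually_fun_upd_in_open[OF assms(1-3)] by eventually_elim (rule assms(4))
qed simp

lemma differentiable_line_cong:
  fixes f g :: "(nat \<Rightarrow> real) \<Rightarrow> real"
  assumes "openin (Euclidean_space n) A" "x \<in> A" "i < n" "\<And>y. y \<in> A \<Longrightarrow> f y = g y"
    and "(\<lambda>t. f (x(i := t))) differentiable (at (x i))"
  shows "(\<lambda>t. g (x(i := t))) differentiable (at (x i))"
proof -
  have ev: "\<forall>\<^sub>F t in nhds (x i). g (x(i := t)) = f (x(i := t))"
    using eventually_fun_upd_in_open[OF assms(1-3)] by eventually_elim (simp add: assms(4))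
  have "((\<lambda>t. g (x(i := t))) has_real_derivative pd i f x) (at (x i))"
    by (rule DERIV_cong_ev[OF refl ev refl, THEN iffD2]) (rule has_derivative_pd[OF assms(5)])
  then show ?thesis unfolding real_differentiable_def by blast
qed

lemma Ck_SucI:
  assumes "continuous_on A f" "\<And>i. i < n \<Longrightarrow> Ck k n A (pd i f)"
    and "\<And>i x. i < n \<Longrightarrow> x \<in> A \<Longrightarrow> (\<lambda>t. f (x(i := t))) differentiable (at (x i))"
  shows "Ck (Suc k) n A f"
  using assms unfolding Ck.simps by blast

lemma Ck_Suc_pd: "Ck (Suc k) n A f \<Longrightarrow> i < n \<Longrightarrow> Ck k n A (pd i f)"
  unfolding Ck.simps by blast

lemma Ck_Suc_differentiable:
  "Ck (Suc k) n A f \<Longrightarrow> i < n \<Longrightarrow> x \<in> A \<Longrightarrow> (\<lambda>t. f (x(i := t))) differentiable (at (x i))"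
  unfolding Ck.simps by blast

lemma Ck_imp_continuous: "Ck k n A f \<Longrightarrow> continuous_on A f"
  by (cases k) auto

lemma Ck_cong:
  assumes "openin (Euclidean_space n) A" "Ck k n A f" "\<And>y. y \<in> A \<Longrightarrow> f y = g y"
  shows "Ck k n A g"
  using assms(2,3)
proof (induction k arbitrary: f g)
  case 0
  have "continuous_on A g = continuous_on A f"
    by (rule continuous_on_cong) (simp_all only: 0(2))
  with 0(1) show ?case unfolding Ck.simps by blast
next
  case (Suc k)
  show ?case
  proof (rule Ck_SucI)
    have "continuous_on A g = continuous_on A f"
      by (rule continuous_on_cong) (simp_all only: Suc.prems(2))
    then show "continuous_on A g" using Ck_imp_continuous[OF Suc.prems(1)] by blast
  next
    fix i assume i: "i < n"
    show "Ck k n A (pd i g)"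
    proof (rule Suc.IH[OF Ck_Suc_pd[OF Suc.prems(1) i]])
      show "pd i f y = pd i g y" if "y \<in> A" for y
        using pd_cong[where f = f and g = g, OF assms(1) that i Suc.prems(2)] by blast
    qed
  next
    show "(\<lambda>t. g (x(i := t))) differentiable (at (x i))" if "i < n" "x \<in> A" for i x
      using differentiable_line_cong[where f = f and g = g, OF assms(1) that(2,1) Suc.prems(2)]
        Ck_Suc_differentiable[OF Suc.prems(1) that] by blast
  qed
qed

lemma Ck_Suc_imp_Ck: "Ck (Suc k) n A f \<Longrightarrow> Ck k n A f"
  by (induction k arbitrary: f) auto

lemma Ck_subset: "Ck k n A f \<Longrightarrow> B \<subseteq> A \<Longrightarrow> Ck k n B f"
  by (induction k arbitrary: f) (auto intro: continuous_on_subset)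

text \<open>
  Openness enters through the continuity of \<open>f\<close>, which is tested within \<open>A\<close> and within the smaller
  sets alike.  The derivatives in \<open>Ck\<close> are pointwise conditions.
\<close>

lemma Ck_local:
  assumes "openin (Euclidean_space n) A"
    and "\<And>x. x \<in> A \<Longrightarrow> \<exists>B. openin (Euclidean_space n) B \<and> x \<in> B \<and> Ck k n B f"
  shows "Ck k n A f"
  using assms(2)
proof (induction k arbitrary: f)
  case 0
  have "continuous (at x within A) f" if xA: "x \<in> A" for x
  proof -
    obtain B where B: "openin (Euclidean_space n) B" "x \<in> B" "continuous_on B f"
      using 0[OF xA] by auto
    obtain S where S: "open S" "B = Rn n \<inter> S"
      using B(1) by (auto simp: Euclidean_space_top_of_set openin_open topspace_Euclidean_space)
    have "at x within (A \<inter> B) = at x within A"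
      using S B(2) openin_subset[OF assms(1)] by (intro at_within_nhd[of x S]) auto
    moreover have "continuous (at x within (A \<inter> B)) f"
      using continuous_on_subset[OF B(3), of "A \<inter> B"] xA B(2)
      by (auto simp: continuous_on_eq_continuous_within)
    ultimately show ?thesis by simp
  qed
  then show ?case by (simp add: continuous_on_eq_continuous_within)
next
  case (Suc k)
  have "Ck k n A f"
  proof (rule Suc.IH)
    fix x assume "x \<in> A"
    from Suc.prems[OF this] show "\<exists>B. openin (Euclidean_space n) B \<and> x \<in> B \<and> Ck k n B f"
      by (elim exE conjE) (intro exI conjI, assumption, assumption, erule Ck_Suc_imp_Ck)
  qed
  then have "continuous_on A f" by (rule Ck_imp_continuous)
  moreover have "Ck k n A (pd i f)" if i: "i < n" for i
  proof (rule Suc.IH)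
    fix x assume "x \<in> A"
    from Suc.prems[OF this] show "\<exists>B. openin (Euclidean_space n) B \<and> x \<in> B \<and> Ck k n B (pd i f)"
      by (elim exE conjE) (intro exI conjI, assumption, assumption, use i in simp)
  qed
  moreover have "(\<lambda>t. f (x(i := t))) differentiable (at (x i))" if i: "i < n" and x: "x \<in> A" for i x
    using Suc.prems[OF x] i by (elim exE conjE) simp
  ultimately show ?case by simp
qed

lemma Ck_const: "Ck k n A (\<lambda>_. c)"
proof (induction k arbitrary: c)
  case (Suc k)
  have "pd i (\<lambda>_. c) = (\<lambda>_. 0)" for i by (simp add: pd_def fun_eq_iff)
  with Suc show ?case by simp
qed simp

lemma pd_add:
  assumes "(\<lambda>t. f (x(i := t))) differentiable (at (x i))" "(\<lambda>t. g (x(i := t))) differentiable (at (x i))"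
  shows "pd i (\<lambda>y. f y + g y) x = pd i f x + pd i g x"
  unfolding pd_def[of i "\<lambda>y. f y + g y"]
  by (rule DERIV_imp_deriv) (intro DERIV_add has_derivative_pd assms)

lemma pd_mult:
  assumes "(\<lambda>t. f (x(i := t))) differentiable (at (x i))" "(\<lambda>t. g (x(i := t))) differentiable (at (x i))"
  shows "pd i (\<lambda>y. f y * g y) x = pd i f x * g x + pd i g x * f x"
  unfolding pd_def[of i "\<lambda>y. f y * g y"]
  by (rule DERIV_imp_deriv)
    (rule DERIV_mult[OF has_derivative_pd[OF assms(1)] has_derivative_pd[OF assms(2)], unfolded fun_upd_triv])

lemma Ck_add:
  assumes "openin (Euclidean_space n) A" "Ck k n A f" "Ck k n A g"
  shows "Ck k n A (\<lambda>y. f y + g y)"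
  using assms(2,3)
proof (induction k arbitrary: f g)
  case (Suc k)
  note d = Suc.prems[THEN Ck_Suc_differentiable]
  show ?case
  proof (rule Ck_SucI)
    fix i assume i: "i < n"
    have "Ck k n A (\<lambda>y. pd i f y + pd i g y)"
      using Suc.prems[THEN Ck_Suc_pd, OF i] Suc.prems[THEN Ck_Suc_imp_Ck]
      by (intro Suc.IH)
    then show "Ck k n A (pd i (\<lambda>y. f y + g y))"
      by (rule Ck_cong[OF assms(1)]) (simp only: pd_add d i)
  next
    show "(\<lambda>t. f (x(i := t)) + g (x(i := t))) differentiable (at (x i))"
      if "i < n" "x \<in> A" for i x
      by (intro differentiable_add d that)
  qed (intro continuous_on_add Suc.prems[THEN Ck_imp_continuous])
qed (unfold Ck.simps, rule continuous_on_add)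

text \<open>
  The product rule keeps one factor undifferentiated in each summand, hence the appeal to
  \<open>Ck_Suc_imp_Ck\<close>.
\<close>

lemma Ck_mult:
  assumes "openin (Euclidean_space n) A" "Ck k n A f" "Ck k n A g"
  shows "Ck k n A (\<lambda>y. f y * g y)"
  using assms(2,3)
proof (induction k arbitrary: f g)
  case (Suc k)
  note d = Suc.prems[THEN Ck_Suc_differentiable]
  show ?case
  proof (rule Ck_SucI)
    fix i assume i: "i < n"
    have "Ck k n A (\<lambda>y. pd i f y * g y + pd i g y * f y)"
      using Suc.prems[THEN Ck_Suc_pd, OF i] Suc.prems[THEN Ck_Suc_imp_Ck]
      by (intro Ck_add[OF assms(1)] Suc.IH)
    then show "Ck k n A (pd i (\<lambda>y. f y * g y))"
      by (rule Ck_cong[OF assms(1)]) (simp only: pd_mult d i)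
  next
    show "(\<lambda>t. f (x(i := t)) * g (x(i := t))) differentiable (at (x i))"
      if "i < n" "x \<in> A" for i x
      by (intro differentiable_mult d that)
  qed (intro continuous_on_mult Suc.prems[THEN Ck_imp_continuous])
qed (unfold Ck.simps, rule continuous_on_mult)

lemma Cinf_cong:
  "openin (Euclidean_space n) A \<Longrightarrow> Cinf n A f \<Longrightarrow> (\<And>y. y \<in> A \<Longrightarrow> f y = g y) \<Longrightarrow> Cinf n A g"
  unfolding Cinf_def using Ck_cong by blast

lemma Cinf_subset: "Cinf n A f \<Longrightarrow> B \<subseteq> A \<Longrightarrow> Cinf n B f"
  unfolding Cinf_def using Ck_subset by blast

lemma Cinf_local:
  assumes "openin (Euclidean_space n) A"
    and "\<And>x. x \<in> A \<Longrightarrow> \<exists>B. openin (Euclidean_space n) B \<and> x \<in> B \<and> Cinf n B f"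
  shows "Cinf n A f"
  unfolding Cinf_def
proof
  show "Ck k n A f" for k
    by (rule Ck_local[OF assms(1)]) (use assms(2) in \<open>unfold Cinf_def, blast\<close>)
qed

lemma Cinf_pd: "Cinf n A f \<Longrightarrow> i < n \<Longrightarrow> Cinf n A (pd i f)"
  unfolding Cinf_def by (metis Ck.simps(2))

lemma Cinf_differentiable:
  "Cinf n A f \<Longrightarrow> i < n \<Longrightarrow> x \<in> A \<Longrightarrow> (\<lambda>t. f (x(i := t))) differentiable (at (x i))"
  unfolding Cinf_def by (metis Ck.simps(2))

lemma Cinf_add:
  "openin (Euclidean_space n) A \<Longrightarrow> Cinf n A f \<Longrightarrow> Cinf n A g \<Longrightarrow> Cinf n A (\<lambda>y. f y + g y)"
  unfolding Cinf_def using Ck_add by blast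

lemma Cinf_mult:
  "openin (Euclidean_space n) A \<Longrightarrow> Cinf n A f \<Longrightarrow> Cinf n A g \<Longrightarrow> Cinf n A (\<lambda>y. f y * g y)"
  unfolding Cinf_def using Ck_mult by blast

section \<open>First-order agreement of functions on a manifold\<close>

text \<open>
  Smoothness and first derivatives are expressed in one chart at a time.  A first-order jet coordinate
  of a section is a partial derivative taken in some chart, and its smoothness is immediate in that
  chart only; the chain rule above compares first derivatives in two charts, which is all that 1-jets
  see.
\<close>

definition in_chart :: "'m chart \<Rightarrow> ('m \<Rightarrow> real) \<Rightarrow> (nat \<Rightarrow> real) \<Rightarrow> real" where
  "in_chart c f y = f (inv_into (fst c) (snd c) y)"

definition smooth_in ::
  "'m::{t2_space, second_countable_topology} manifold \<Rightarrow> 'm chart \<Rightarrow> 'm set \<Rightarrow> ('m \<Rightarrow> real) \<Rightarrow> bool" where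
  "smooth_in M c A f \<longleftrightarrow> Cinf (mdim M) (snd c ` (fst c \<inter> A)) (in_chart c f)"

definition same_1jet_in ::
  "'m::{t2_space, second_countable_topology} manifold \<Rightarrow> 'm chart \<Rightarrow> 'm \<Rightarrow> ('m \<Rightarrow> real) \<Rightarrow> ('m \<Rightarrow> real) \<Rightarrow> bool" where
  "same_1jet_in M c m f g \<longleftrightarrow> f m = g m \<and>
     (\<forall>i<mdim M. pd i (in_chart c f) (snd c m) = pd i (in_chart c g) (snd c m))"

lemma smooth_fun_on_iff: "smooth_fun_on M A f \<longleftrightarrow> (\<forall>c\<in>charts M. smooth_in M c A f)"
  by (simp add: smooth_fun_on_def smooth_in_def in_chart_def[abs_def] case_prod_unfold)

context
  fixes M :: "'m::{t2_space, second_countable_topology} manifold" and c :: "'m chart"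
  assumes M: "smooth_manifold M" and c: "c \<in> charts M"
begin

lemma chart_homeomorphism: "open (fst c)" "openin (Euclidean_space (mdim M)) (snd c ` fst c)"
  "homeomorphism (fst c) (snd c ` fst c) (snd c) (inv_into (fst c) (snd c))"
  using M c unfolding smooth_manifold_def case_prod_unfold by blast+

lemma chart_inverse: "x \<in> fst c \<Longrightarrow> inv_into (fst c) (snd c) (snd c x) = x"
  using chart_homeomorphism(3) by (auto simp: homeomorphism_def)

lemma in_chart_image: "x \<in> fst c \<Longrightarrow> in_chart c f (snd c x) = f x"
  by (simp add: in_chart_def chart_inverse)

text \<open>
  A chart is a homeomorphism onto an open set, so it maps relatively open sets to sets that are open in
  \<open>\<real>\<^sup>n\<close>.
\<close>

lemma open_chart_image:
  assumes "open A"
  shows "openin (Euclidean_space (mdim M)) (snd c ` (fst c \<inter> A))"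
proof -
  have "openin (top_of_set (fst c)) (fst c \<inter> A)" using assms by blast
  then have "openin (top_of_set (snd c ` fst c)) (snd c ` (fst c \<inter> A))"
    using homeomorphism_imp_open_map[OF chart_homeomorphism(3)] by blast
  then show ?thesis
    using chart_homeomorphism(2) openin_trans unfolding Euclidean_space_top_of_set by blast
qed

lemma smooth_in_cong:
  assumes "open A" "smooth_in M c A f" "\<And>x. x \<in> fst c \<Longrightarrow> x \<in> A \<Longrightarrow> f x = g x"
  shows "smooth_in M c A g"
  unfolding smooth_in_def
  by (rule Cinf_cong[OF open_chart_image[OF assms(1)] assms(2)[unfolded smooth_in_def]])
    (auto simp: in_chart_image assms(3))

lemma smooth_in_subset: "smooth_in M c A f \<Longrightarrow> B \<subseteq> A \<Longrightarrow> smooth_in M c B f"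
  unfolding smooth_in_def by (rule Cinf_subset) auto

lemma smooth_in_local:
  assumes "open A" "\<And>x. x \<in> fst c \<Longrightarrow> x \<in> A \<Longrightarrow> \<exists>B. open B \<and> x \<in> B \<and> smooth_in M c B f"
  shows "smooth_in M c A f"
  unfolding smooth_in_def
proof (rule Cinf_local[OF open_chart_image[OF assms(1)]])
  fix y assume "y \<in> snd c ` (fst c \<inter> A)"
  then obtain x where x: "x \<in> fst c" "x \<in> A" "y = snd c x" by blast
  obtain B where "open B" "x \<in> B" "smooth_in M c B f" using assms(2)[OF x(1,2)] by blast
  then show "\<exists>B. openin (Euclidean_space (mdim M)) B \<and> y \<in> B \<and> Cinf (mdim M) B (in_chart c f)"
    using open_chart_image[of B] x unfolding smooth_in_def by blast
qed

lemma smooth_in_const: "smooth_in M c A (\<lambda>_. k)"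
  by (simp add: smooth_in_def in_chart_def[abs_def] Cinf_def Ck_const)

lemma smooth_in_add:
  "open A \<Longrightarrow> smooth_in M c A f \<Longrightarrow> smooth_in M c A g \<Longrightarrow> smooth_in M c A (\<lambda>x. f x + g x)"
  unfolding smooth_in_def in_chart_def using Cinf_add open_chart_image by blast

lemma smooth_in_mult:
  "open A \<Longrightarrow> smooth_in M c A f \<Longrightarrow> smooth_in M c A g \<Longrightarrow> smooth_in M c A (\<lambda>x. f x * g x)"
  unfolding smooth_in_def in_chart_def using Cinf_mult open_chart_image by blast

lemma smooth_in_sum:
  fixes N :: nat
  assumes "open A" "\<And>b. b < N \<Longrightarrow> smooth_in M c A (f b)"
  shows "smooth_in M c A (\<lambda>x. \<Sum>b<N. f b x)"
  using assms(2)
proof (induction N)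
  case 0
  show ?case by (simp add: smooth_in_const)
next
  case (Suc N)
  then show ?case unfolding sum.lessThan_Suc by (intro smooth_in_add assms(1)) auto
qed

lemma smooth_in_differentiable:
  assumes "smooth_in M c A f" "m \<in> fst c" "m \<in> A" "i < mdim M"
  shows "(\<lambda>t. in_chart c f ((snd c m)(i := t))) differentiable (at (snd c m i))"
  using Cinf_differentiable[OF assms(1)[unfolded smooth_in_def] assms(4)] assms(2,3) by blast

lemma pd_in_chart_cong:
  assumes "open A" "m \<in> A" "m \<in> fst c" "\<And>x. x \<in> A \<Longrightarrow> f x = g x" "i < mdim M"
  shows "pd i (in_chart c f) (snd c m) = pd i (in_chart c g) (snd c m)"
  by (rule pd_cong[OF open_chart_image[OF assms(1)] _ assms(5)])
    (use assms in_chart_image in auto)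

lemma pd_in_chart_add:
  assumes "smooth_in M c A f" "smooth_in M c A g" "m \<in> fst c" "m \<in> A" "i < mdim M"
  shows "pd i (in_chart c (\<lambda>x. f x + g x)) (snd c m) =
    pd i (in_chart c f) (snd c m) + pd i (in_chart c g) (snd c m)"
  using pd_add[OF smooth_in_differentiable[OF assms(1,3-5)] smooth_in_differentiable[OF assms(2-5)]]
  by (simp add: in_chart_def[abs_def])

lemma pd_in_chart_mult:
  assumes "smooth_in M c A f" "smooth_in M c A g" "m \<in> fst c" "m \<in> A" "i < mdim M"
  shows "pd i (in_chart c (\<lambda>x. f x * g x)) (snd c m) =
    pd i (in_chart c f) (snd c m) * g m + pd i (in_chart c g) (snd c m) * f m"
  using pd_mult[OF smooth_in_differentiable[OF assms(1,3-5)] smooth_in_differentiable[OF assms(2-5)]]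
  by (simp add: in_chart_def[abs_def] chart_inverse[OF assms(3)])

lemma same_1jet_in_cong:
  assumes "open A" "m \<in> A" "m \<in> fst c" "\<And>x. x \<in> A \<Longrightarrow> f x = f' x" "\<And>x. x \<in> A \<Longrightarrow> g x = g' x"
    and "same_1jet_in M c m f g"
  shows "same_1jet_in M c m f' g'"
  using assms(6) pd_in_chart_cong[where f = f and g = f', OF assms(1-4)]
    pd_in_chart_cong[where f = g and g = g', OF assms(1-3,5)] assms(2,4,5)
  unfolding same_1jet_in_def by simp

text \<open>
  The coefficients \<open>h b\<close> are shared, so by the product rule the 1-jet of the combination depends only on
  those of the \<open>f b\<close>.
\<close>

lemma same_1jet_in_sum_mult:
  fixes N :: nat
  assumes "open A" "m \<in> A" "m \<in> fst c"
    and "\<And>b. b < N \<Longrightarrow> smooth_in M c A (f b)" "\<And>b. b < N \<Longrightarrow> smooth_in M c A (g b)"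
    and "\<And>b. b < N \<Longrightarrow> smooth_in M c A (h b)"
    and "\<And>b. b < N \<Longrightarrow> same_1jet_in M c m (f b) (g b)"
  shows "same_1jet_in M c m (\<lambda>x. \<Sum>b<N. f b x * h b x) (\<lambda>x. \<Sum>b<N. g b x * h b x)"
  using assms(4-7)
proof (induction N)
  case 0
  show ?case by (simp add: same_1jet_in_def)
next
  case (Suc N)
  have sm: "smooth_in M c A (\<lambda>x. \<Sum>b<N. k b x * h b x)" "smooth_in M c A (\<lambda>x. k N x * h N x)"
    if "\<forall>b<Suc N. smooth_in M c A (k b)" for k
    using that Suc.prems(3) by (intro smooth_in_sum smooth_in_mult assms(1); simp)+
  have smf: "\<forall>b<Suc N. smooth_in M c A (f b)" and smg: "\<forall>b<Suc N. smooth_in M c A (g b)"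
    using Suc.prems(1,2) by blast+
  have IH: "same_1jet_in M c m (\<lambda>x. \<Sum>b<N. f b x * h b x) (\<lambda>x. \<Sum>b<N. g b x * h b x)"
    using Suc.prems by (intro Suc.IH) auto
  have ag: "same_1jet_in M c m (f N) (g N)" using Suc.prems(4) by simp
  have N: "N < Suc N" by simp
  show ?case
    unfolding sum.lessThan_Suc same_1jet_in_def
    using IH ag pd_in_chart_add[OF sm[OF smf] assms(3,2)]
      pd_in_chart_add[OF sm[OF smg] assms(3,2)]
      pd_in_chart_mult[OF Suc.prems(1)[OF N] Suc.prems(3)[OF N] assms(3,2)]
      pd_in_chart_mult[OF Suc.prems(2)[OF N] Suc.prems(3)[OF N] assms(3,2)]
    by (simp add: same_1jet_in_def)
qed

end

lemma smooth_fun_on_chart_coordinate: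
  assumes "smooth_manifold M" "c \<in> charts M" "i < mdim M"
  shows "smooth_fun_on M (fst c) (\<lambda>x. snd c x i)"
  using assms unfolding smooth_manifold_def smooth_fun_on_def case_prod_unfold by blast

text \<open>
  A coordinate line of \<open>c'\<close> through \<open>m\<close>, read in the chart \<open>c\<close>, is a curve with differentiable components
  because the transition functions are smooth; the chain rule is applied to \<open>f\<close> along it.
\<close>

lemma pd_change_of_chart:
  assumes M: "smooth_manifold M" and c: "c \<in> charts M" and c': "c' \<in> charts M"
    and A: "open A" "m \<in> A" "m \<in> fst c" "m \<in> fst c'" and f: "smooth_in M c A f" and i: "i < mdim M"
  shows "pd i (in_chart c' f) (snd c' m) = (\<Sum>j<mdim M.
    pd j (in_chart c f) (snd c m) * pd i (in_chart c' (\<lambda>x. snd c x j)) (snd c' m))"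
proof -
  define n where "n = mdim M"
  define t0 where "t0 = snd c' m i"
  \<comment> \<open>the coordinate line read in the other chart\<close>
  define \<gamma> where "\<gamma> t = snd c (inv_into (fst c') (snd c') ((snd c' m)(i := t)))" for t
  have \<gamma>0: "\<gamma> t0 = snd c m" by (simp add: \<gamma>_def t0_def chart_inverse[OF M c' A(4)])
  define B where "B = fst c \<inter> A"
  have B: "open B" "m \<in> B" using A chart_homeomorphism[OF M c] by (auto simp: B_def)
  have "\<forall>\<^sub>F t in nhds t0. (snd c' m)(i := t) \<in> snd c' ` (fst c' \<inter> B)"
    unfolding t0_def using eventually_fun_upd_in_open[OF open_chart_image[OF M c' B(1)] _ i] A B by blast
  then have near: "\<forall>\<^sub>F t in nhds t0. \<gamma> t \<in> snd c ` (fst c \<inter> A) \<and>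
      in_chart c f (\<gamma> t) = in_chart c' f ((snd c' m)(i := t))"
  proof eventually_elim
    case (elim t)
    then obtain x where x: "x \<in> fst c'" "x \<in> B" "(snd c' m)(i := t) = snd c' x" by blast
    then have "\<gamma> t = snd c x" by (simp add: \<gamma>_def chart_inverse[OF M c'])
    with x show ?case by (auto simp: B_def in_chart_image[OF M c] in_chart_image[OF M c'])
  qed
  have R: "\<forall>\<^sub>F t in at t0. \<gamma> t \<in> Rn n"
    using eventually_nhds_conv_at[THEN iffD1, OF near, THEN conjunct1]
    by eventually_elim
      (use openin_Euclidean_subset_Rn[OF open_chart_image[OF M c A(1)]] in \<open>auto simp: n_def\<close>)
  have d: "((\<lambda>t. \<gamma> t j) has_real_derivative pd i (in_chart c' (\<lambda>x. snd c x j)) (snd c' m)) (at t0)"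
    if "j < n" for j
  proof -
    have "smooth_in M c' (fst c) (\<lambda>x. snd c x j)"
      using smooth_fun_on_chart_coordinate[OF M c] c' that by (simp add: smooth_fun_on_iff n_def)
    from has_derivative_pd[OF smooth_in_differentiable[OF M c' this A(4,3) i]]
    show ?thesis unfolding \<gamma>_def t0_def in_chart_def .
  qed
  have "Ck 1 n (snd c ` (fst c \<inter> A)) (in_chart c f)"
    using f unfolding smooth_in_def Cinf_def n_def by blast
  from chain_rule_C1[OF open_chart_image[OF M c A(1), folded n_def] this _ R d]
  have "((\<lambda>t. in_chart c f (\<gamma> t)) has_real_derivative (\<Sum>j<n.
      pd j (in_chart c f) (\<gamma> t0) * pd i (in_chart c' (\<lambda>x. snd c x j)) (snd c' m))) (at t0)"
    using A \<gamma>0 by auto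
  moreover have "\<forall>\<^sub>F t in nhds t0. in_chart c f (\<gamma> t) = in_chart c' f ((snd c' m)(i := t))"
    using near by eventually_elim blast
  ultimately have "((\<lambda>t. in_chart c' f ((snd c' m)(i := t))) has_real_derivative (\<Sum>j<n.
      pd j (in_chart c f) (\<gamma> t0) * pd i (in_chart c' (\<lambda>x. snd c x j)) (snd c' m))) (at t0)"
    by (simp only: DERIV_cong_ev[OF refl _ refl])
  from DERIV_imp_deriv[OF this[unfolded \<gamma>0]] show ?thesis
    unfolding n_def pd_def[of i "in_chart c' f"] t0_def .
qed

lemma same_1jet_in_change_of_chart:
  assumes "smooth_manifold M" "c \<in> charts M" "c' \<in> charts M"
    and "open A" "m \<in> A" "m \<in> fst c" "m \<in> fst c'" and "smooth_in M c A f" "smooth_in M c A g"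
    and "same_1jet_in M c m f g"
  shows "same_1jet_in M c' m f g"
  using assms(10) pd_change_of_chart[OF assms(1-8)] pd_change_of_chart[OF assms(1-7,9)]
  unfolding same_1jet_in_def by simp

section \<open>Change of local trivialisation\<close>

text \<open>
  The part of being a vector bundle on which linear algebra in the fibres depends.  The first jet bundle
  has it because jets are added and scaled through representatives, and together with local trivialisations
  it is enough to pass between induced and adapted coordinates.
\<close>

definition linear_fibres :: "('m, 'e, 'z) vbundle_scheme \<Rightarrow> bool" where
  "linear_fibres E \<longleftrightarrow> (\<forall>x. \<forall>e\<in>fibre E x. (\<forall>e'\<in>fibre E x. badd E e e' \<in> fibre E x) \<and>
     (\<forall>k. bscale E k e \<in> fibre E x))"

definition frame :: "('m, 'e, 'z) vbundle_scheme \<Rightarrow> ('m, 'e) triv \<Rightarrow> nat \<Rightarrow> 'm \<Rightarrow> 'e" where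
  "frame E T b x = inv_into (fibre E x) (snd T) (\<lambda>i. if i = b then 1 else 0)"

lemma vector_bundle_linear_fibres: "vector_bundle M E \<Longrightarrow> linear_fibres E"
  unfolding vector_bundle_def linear_fibres_def by blast

lemma local_trivD:
  assumes "local_triv E T"
  shows "open (fst T)"
    and "x \<in> fst T \<Longrightarrow> bij_betw (snd T) (fibre E x) (Rn (brank E))"
    and "x \<in> fst T \<Longrightarrow> e \<in> fibre E x \<Longrightarrow> e' \<in> fibre E x \<Longrightarrow> snd T (badd E e e') a = snd T e a + snd T e' a"
    and "x \<in> fst T \<Longrightarrow> e \<in> fibre E x \<Longrightarrow> snd T (bscale E k e) a = k * snd T e a"
  using assms unfolding local_triv_def case_prod_unfold by (blast, blast, simp, simp)

lemma local_triv_inv: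
  assumes "local_triv E T" "x \<in> fst T" "v \<in> Rn (brank E)"
  shows "inv_into (fibre E x) (snd T) v \<in> fibre E x" "snd T (inv_into (fibre E x) (snd T) v) = v"
  using local_trivD(2)[OF assms(1,2)] assms(3)
  by (auto simp: bij_betw_def intro: inv_into_into f_inv_into_f)

text \<open>
  A trivialisation is linear and injective on the fibre, so \<open>e\<close> is assembled from multiples of the frame,
  one coordinate at a time, and an additive and homogeneous \<open>h\<close> follows along.
\<close>

lemma linear_expansion_in_frame:
  assumes E: "linear_fibres E" and T: "local_triv E T" "x \<in> fst T" and e: "e \<in> fibre E x"
    and add: "\<And>u v. u \<in> fibre E x \<Longrightarrow> v \<in> fibre E x \<Longrightarrow> h (badd E u v) = h u + h v"
    and scale: "\<And>k u. u \<in> fibre E x \<Longrightarrow> h (bscale E k u) = k * h u"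
  shows "h e = (\<Sum>b<brank E. snd T e b * (h (frame E T b x) :: real))"
proof -
  define r where "r = brank E"
  \<comment> \<open>the element whose coordinates agree with those of \<open>e\<close> below \<open>k\<close> and vanish from \<open>k\<close> on\<close>
  define cut where "cut k = inv_into (fibre E x) (snd T) (\<lambda>i. if i < k then snd T e i else 0)" for k
  have inj: "u = v" if "u \<in> fibre E x" "v \<in> fibre E x" "\<And>a. snd T u a = snd T v a" for u v
    using local_trivD(2)[OF T] that unfolding bij_betw_def by (blast dest: inj_onD)
  have cut: "cut k \<in> fibre E x" "snd T (cut k) = (\<lambda>i. if i < k then snd T e i else 0)" if "k \<le> r" for k
    using local_triv_inv[OF T, of "\<lambda>i. if i < k then snd T e i else 0"] that
    by (auto simp: cut_def r_def topspace_Euclidean_space)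
  have frame: "frame E T b x \<in> fibre E x" "snd T (frame E T b x) = (\<lambda>i. if i = b then 1 else 0)"
    if "b < r" for b
    using local_triv_inv[OF T, of "\<lambda>i. if i = b then 1 else 0"] that
    by (auto simp: frame_def r_def topspace_Euclidean_space)
  have "h (cut k) = (\<Sum>b<k. snd T e b * h (frame E T b x))" if "k \<le> r" for k
    using that
  proof (induction k)
    case 0
    \<comment> \<open>the zero vector is fixed by the scalar 0, which makes \<open>h\<close> vanish on it\<close>
    have "cut 0 = bscale E 0 (cut 0)"
      using cut[of 0] E local_trivD(4)[OF T cut(1)[of 0]]
      by (intro inj) (auto simp: linear_fibres_def)
    then have "h (cut 0) = 0 * h (cut 0)" using scale[OF cut(1)[of 0], of 0] by (simp only:)
    then show ?case by simp
  next
    case (Suc k)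
    then have k: "k \<le> r" "k < r" by auto
    let ?u = "bscale E (snd T e k) (frame E T k x)"
    have u: "?u \<in> fibre E x" using E frame(1)[OF k(2)] by (auto simp: linear_fibres_def)
    have "cut (Suc k) = badd E (cut k) ?u"
    proof (rule inj)
      show "cut (Suc k) \<in> fibre E x" by (rule cut(1)[OF Suc.prems])
      show "badd E (cut k) ?u \<in> fibre E x"
        using E u cut(1)[OF k(1)] by (auto simp: linear_fibres_def)
      show "snd T (cut (Suc k)) a = snd T (badd E (cut k) ?u) a" for a
        using local_trivD(3)[OF T cut(1)[OF k(1)] u] local_trivD(4)[OF T frame(1)[OF k(2)]]
          cut(2)[OF k(1)] cut(2)[OF Suc.prems] frame(2)[OF k(2)] by (auto simp: less_Suc_eq)
    qed
    then show ?case
      using add[OF cut(1)[OF k(1)] u] scale[OF frame(1)[OF k(2)]] Suc.IH[OF k(1)] by simp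
  qed
  moreover have "cut r = e"
  proof (rule inj)
    show "snd T (cut r) a = snd T e a" for a
    proof -
      have "snd T e \<in> Rn r" using local_trivD(2)[OF T] e unfolding bij_betw_def r_def by blast
      then show ?thesis using cut(2)[of r] by (auto simp: topspace_Euclidean_space)
    qed
  qed (use cut e in auto)
  ultimately show ?thesis unfolding r_def by fastforce
qed

lemma change_of_triv:
  assumes "linear_fibres E" "local_triv E T" "local_triv E T'" "x \<in> fst T" "x \<in> fst T'" "e \<in> fibre E x"
  shows "snd T' e a = (\<Sum>b<brank E. snd T e b * snd T' (frame E T b x) a)"
  using assms local_trivD(3,4)[OF assms(3,5)]
  by (intro linear_expansion_in_frame[where h = "\<lambda>e. snd T' e a"]) auto

lemma smooth_transition_frame:
  assumes "smooth_transition M E T T'" "b < brank E" "a < brank E"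
  shows "smooth_fun_on M (fst T \<inter> fst T') (\<lambda>x. snd T' (frame E T b x) a)"
proof -
  have "(\<lambda>i. if i = b then 1 else 0) \<in> Rn (brank E)"
    using assms(2) by (auto simp: topspace_Euclidean_space)
  then show ?thesis
    using assms(1,3) unfolding smooth_transition_def case_prod_unfold frame_def by blast
qed

context
  fixes M :: "'m::{t2_space, second_countable_topology} manifold" and c :: "'m chart"
    and E :: "('m, 'e, 'z) vbundle_scheme" and T T' :: "('m, 'e) triv" and A :: "'m set"
  assumes M: "smooth_manifold M" and c: "c \<in> charts M"
    and E: "linear_fibres E" "local_triv E T" "local_triv E T'" "smooth_transition M E T T'"
    and A: "open A" "A \<subseteq> fst T \<inter> fst T'"
begin

lemma smooth_in_frame: "b < brank E \<Longrightarrow> a < brank E \<Longrightarrow> smooth_in M c A (\<lambda>x. snd T' (frame E T b x) a)"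
  using smooth_transition_frame[OF E(4)] A(2) c smooth_in_subset[OF M c]
  unfolding smooth_fun_on_iff by blast

text \<open>
  The new coordinates are combinations of the old ones, with the smooth coordinates of the old frame
  as coefficients.
\<close>

lemma smooth_in_change_of_triv:
  assumes s: "\<And>x. x \<in> A \<Longrightarrow> s x \<in> fibre E x"
    and "\<And>b. b < brank E \<Longrightarrow> smooth_in M c A (\<lambda>x. snd T (s x) b)" and a: "a < brank E"
  shows "smooth_in M c A (\<lambda>x. snd T' (s x) a)"
proof (rule smooth_in_cong[OF M c A(1)])
  show "smooth_in M c A (\<lambda>x. \<Sum>b<brank E. snd T (s x) b * snd T' (frame E T b x) a)"
    by (intro smooth_in_sum[OF M c] smooth_in_mult[OF M c] A(1) assms(2) smooth_in_frame a)
  show "(\<Sum>b<brank E. snd T (s x) b * snd T' (frame E T b x) a) = snd T' (s x) a" if "x \<in> A" for x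
    by (rule change_of_triv[OF E(1-3) _ _ s[OF that], symmetric]) (use that A(2) in blast)+
qed

lemma same_1jet_in_change_of_triv:
  assumes m: "m \<in> A" "m \<in> fst c"
    and s: "\<And>x. x \<in> A \<Longrightarrow> s x \<in> fibre E x" "\<And>x. x \<in> A \<Longrightarrow> s' x \<in> fibre E x"
    and sm: "\<And>b. b < brank E \<Longrightarrow> smooth_in M c A (\<lambda>x. snd T (s x) b)"
      "\<And>b. b < brank E \<Longrightarrow> smooth_in M c A (\<lambda>x. snd T (s' x) b)"
    and "\<And>b. b < brank E \<Longrightarrow> same_1jet_in M c m (\<lambda>x. snd T (s x) b) (\<lambda>x. snd T (s' x) b)"
    and a: "a < brank E"
  shows "same_1jet_in M c m (\<lambda>x. snd T' (s x) a) (\<lambda>x. snd T' (s' x) a)"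
proof (rule same_1jet_in_cong[OF M c A(1) m])
  show "same_1jet_in M c m (\<lambda>x. \<Sum>b<brank E. snd T (s x) b * snd T' (frame E T b x) a)
      (\<lambda>x. \<Sum>b<brank E. snd T (s' x) b * snd T' (frame E T b x) a)"
    by (rule same_1jet_in_sum_mult[OF M c A(1) m]) (intro sm assms(7) smooth_in_frame a; assumption)+
  show "(\<Sum>b<brank E. snd T (s x) b * snd T' (frame E T b x) a) = snd T' (s x) a" if "x \<in> A" for x
    by (rule change_of_triv[OF E(1-3) _ _ s(1)[OF that], symmetric]) (use that A(2) in blast)+
  show "(\<Sum>b<brank E. snd T (s' x) b * snd T' (frame E T b x) a) = snd T' (s' x) a" if "x \<in> A" for x
    by (rule change_of_triv[OF E(1-3) _ _ s(2)[OF that], symmetric]) (use that A(2) in blast)+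
qed

end

section \<open>Jets and local sections\<close>

lemma same_jet_sym: "same_jet M E k m s s' \<Longrightarrow> same_jet M E k m s' s"
  unfolding same_jet_def case_prod_unfold by (intro ballI impI allI) simp

lemma same_jet_trans: "same_jet M E k m s s' \<Longrightarrow> same_jet M E k m s' s'' \<Longrightarrow> same_jet M E k m s s''"
  unfolding same_jet_def case_prod_unfold by (intro ballI impI allI) simp

lemma jet_eqI: "same_jet M E k m s s' \<Longrightarrow> jet M E k s m = jet M E k s' m"
  unfolding jet_def using same_jet_sym same_jet_trans by blast

lemma fst_jet [simp]: "fst (jet M E k s m) = m"
  by (simp add: jet_def)

lemma jet_rep_jet:
  assumes "local_section M E m s"
  shows "local_section M E m (jet_rep (jet M E k s m))" "same_jet M E k m s (jet_rep (jet M E k s m))"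
proof -
  have "same_jet M E k m s s" by (simp add: same_jet_def)
  with assms have "s \<in> snd (jet M E k s m)" by (simp add: jet_def)
  then have "jet_rep (jet M E k s m) \<in> snd (jet M E k s m)" unfolding jet_rep_def by (metis someI_ex)
  then show "local_section M E m (jet_rep (jet M E k s m))" "same_jet M E k m s (jet_rep (jet M E k s m))"
    by (auto simp: jet_def)
qed

lemma same_jet_in_charts:
  "same_jet M E k m s s' \<longleftrightarrow>
    (\<forall>c\<in>charts M. \<forall>T\<in>trivs E. m \<in> fst c \<longrightarrow> m \<in> fst T \<longrightarrow> (\<forall>a<brank E. \<forall>js\<in>lists {..<mdim M}.
      length js \<le> k \<longrightarrow> pds js (in_chart c (\<lambda>x. snd T (s x) a)) (snd c m) =
        pds js (in_chart c (\<lambda>x. snd T (s' x) a)) (snd c m)))"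
  unfolding same_jet_def in_chart_def[abs_def] case_prod_unfold by blast

text \<open>
  The derivative lists of length at most 1 are the empty list, which gives the value, and the
  singletons.
\<close>

lemma same_jet_1_iff:
  assumes M: "smooth_manifold M"
  shows "same_jet M E 1 m s s' \<longleftrightarrow>
    (\<forall>c\<in>charts M. \<forall>T\<in>trivs E. m \<in> fst c \<longrightarrow> m \<in> fst T \<longrightarrow>
      (\<forall>a<brank E. same_1jet_in M c m (\<lambda>x. snd T (s x) a) (\<lambda>x. snd T (s' x) a)))"
proof -
  have "(\<forall>js\<in>lists {..<mdim M}. length js \<le> 1 \<longrightarrow> pds js F p = pds js G p) \<longleftrightarrow>
      F p = G p \<and> (\<forall>i<mdim M. pd i F p = pd i G p)" (is "?L \<longleftrightarrow> ?R") for F G p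
  proof
    assume L: ?L
    from bspec[OF L, of "[]"] have "F p = G p" by (simp add: pds_def)
    moreover have "pd i F p = pd i G p" if "i < mdim M" for i
      using bspec[OF L, of "[i]"] that by (simp add: pds_def)
    ultimately show ?R by blast
  next
    assume R: ?R
    show ?L
    proof (intro ballI impI)
      fix js assume js: "js \<in> lists {..<mdim M}" "length js \<le> 1"
      then consider "js = []" | i where "js = [i]" "i < mdim M" by (cases js) auto
      then show "pds js F p = pds js G p" by cases (use R in \<open>auto simp: pds_def\<close>)
    qed
  qed
  then show ?thesis
    unfolding same_jet_in_charts same_1jet_in_def by (simp add: in_chart_image[OF M] cong: conj_cong)
qed

lemma smooth_section_on_iff:
  "smooth_section_on M E A s \<longleftrightarrow> (\<forall>x\<in>A. s x \<in> fibre E x) \<and>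
    (\<forall>T\<in>trivs E. \<forall>a<brank E. \<forall>c\<in>charts M. smooth_in M c (fst T \<inter> A) (\<lambda>x. snd T (s x) a))"
  unfolding smooth_section_on_def case_prod_unfold smooth_fun_on_iff by blast

lemma local_sectionE:
  assumes M: "smooth_manifold M" and E: "vector_bundle M E"
    and s: "local_section M E m s" and T: "T \<in> trivs E" "m \<in> fst T"
  obtains A where "open A" "m \<in> A" "A \<subseteq> fst T" "\<And>x. x \<in> A \<Longrightarrow> s x \<in> fibre E x"
    "\<And>c a. c \<in> charts M \<Longrightarrow> a < brank E \<Longrightarrow> smooth_in M c A (\<lambda>x. snd T (s x) a)"
proof -
  obtain A where A: "open A" "m \<in> A" "smooth_section_on M E A s"
    using s unfolding local_section_def by blast
  have "open (fst T)" using E T unfolding vector_bundle_def by (blast intro: local_trivD)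
  then show ?thesis
    using A T by (intro that[of "fst T \<inter> A"]) (auto simp: smooth_section_on_iff)
qed

context
  fixes M :: "'m::{t2_space, second_countable_topology} manifold" and E :: "('m, 'e, 'z) vbundle_scheme"
  assumes M: "smooth_manifold M" and E: "vector_bundle M E"
begin

lemma local_triv_trivs: "T \<in> trivs E \<Longrightarrow> local_triv E T"
  using E unfolding vector_bundle_def by blast

lemma smooth_transition_trivs: "T \<in> trivs E \<Longrightarrow> T' \<in> trivs E \<Longrightarrow> smooth_transition M E T T'"
  using E unfolding vector_bundle_def by blast

lemma local_section_sec_add:
  assumes "local_section M E m s" "local_section M E m s'"
  shows "local_section M E m (sec_add E s s')"
proof -
  obtain A where A: "open A" "m \<in> A" "smooth_section_on M E A s"
    using assms(1) unfolding local_section_def by blast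
  obtain B where B: "open B" "m \<in> B" "smooth_section_on M E B s'"
    using assms(2) unfolding local_section_def by blast
  have "smooth_section_on M E (A \<inter> B) (sec_add E s s')"
    unfolding smooth_section_on_iff
  proof (intro conjI ballI allI impI)
    show "sec_add E s s' x \<in> fibre E x" if "x \<in> A \<inter> B" for x
      using that A(3) B(3) vector_bundle_linear_fibres[OF E]
      by (simp add: smooth_section_on_def sec_add_def linear_fibres_def)
  next
    fix T a c assume T: "T \<in> trivs E" and a: "a < brank E" and c: "c \<in> charts M"
    have o: "open (fst T \<inter> (A \<inter> B))" using A B local_trivD(1)[OF local_triv_trivs[OF T]] by blast
    have "smooth_in M c (fst T \<inter> (A \<inter> B)) (\<lambda>x. snd T (s x) a)"
         "smooth_in M c (fst T \<inter> (A \<inter> B)) (\<lambda>x. snd T (s' x) a)"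
      using A(3) B(3) T a c unfolding smooth_section_on_iff
      by (blast intro: smooth_in_subset[OF M c])+
    then have "smooth_in M c (fst T \<inter> (A \<inter> B)) (\<lambda>x. snd T (s x) a + snd T (s' x) a)"
      by (rule smooth_in_add[OF M c o])
    then show "smooth_in M c (fst T \<inter> (A \<inter> B)) (\<lambda>x. snd T (sec_add E s s' x) a)"
      by (rule smooth_in_cong[OF M c o])
        (use A(3) B(3) in \<open>auto simp: sec_add_def smooth_section_on_def local_trivD(3)[OF local_triv_trivs[OF T]]\<close>)
  qed
  then show ?thesis unfolding local_section_def using A B by blast
qed

lemma local_section_sec_scale:
  assumes "local_section M E m s"
  shows "local_section M E m (sec_scale E (\<lambda>_. k) s)"
proof -
  obtain A where A: "open A" "m \<in> A" "smooth_section_on M E A s"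
    using assms(1) unfolding local_section_def by blast
  have "smooth_section_on M E A (sec_scale E (\<lambda>_. k) s)"
    unfolding smooth_section_on_iff
  proof (intro conjI ballI allI impI)
    show "sec_scale E (\<lambda>_. k) s x \<in> fibre E x" if "x \<in> A" for x
      using that A(3) vector_bundle_linear_fibres[OF E]
      by (simp add: smooth_section_on_def sec_scale_def linear_fibres_def)
  next
    fix T a c assume T: "T \<in> trivs E" and a: "a < brank E" and c: "c \<in> charts M"
    have o: "open (fst T \<inter> A)" using A local_trivD(1)[OF local_triv_trivs[OF T]] by blast
    have "smooth_in M c (fst T \<inter> A) (\<lambda>x. snd T (s x) a)"
      using A(3) T a c unfolding smooth_section_on_iff by blast
    then have "smooth_in M c (fst T \<inter> A) (\<lambda>x. k * snd T (s x) a)"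
      by (rule smooth_in_mult[OF M c o smooth_in_const[OF M c]])
    then show "smooth_in M c (fst T \<inter> A) (\<lambda>x. snd T (sec_scale E (\<lambda>_. k) s x) a)"
      by (rule smooth_in_cong[OF M c o])
        (use A(3) in \<open>auto simp: sec_scale_def smooth_section_on_def local_trivD(4)[OF local_triv_trivs[OF T]]\<close>)
  qed
  then show ?thesis unfolding local_section_def using A by blast
qed

end

section \<open>Local trivialisations of the first jet bundle\<close>

text \<open>
  The index arithmetic of \<open>J1_coord\<close>, with \<open>n\<close> the dimension and \<open>r\<close> the rank: \<open>b div r\<close> is 0 for a
  component of the section and \<open>j + 1\<close> for its derivative in direction \<open>j\<close>.
\<close>

lemma J1_index:
  fixes b n r :: nat
  assumes "b < (n + 1) * r"
  shows "b mod r < r" "b div r \<le> n" "b < r \<longleftrightarrow> b div r = 0" "b < r \<Longrightarrow> b mod r = b"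
    "\<not> b < r \<Longrightarrow> b div r - 1 < n"
proof -
  have r: "r > 0" using assms by (cases "r = 0") auto
  show "b mod r < r" using r by simp
  have "b div r < n + 1" using assms r by (simp add: less_mult_imp_div_less)
  then show le: "b div r \<le> n" by simp
  show iff: "b < r \<longleftrightarrow> b div r = 0" using r by (simp add: div_eq_0_iff)
  show "b < r \<Longrightarrow> b mod r = b" by simp
  show "\<not> b < r \<Longrightarrow> b div r - 1 < n" using le iff by simp
qed

lemma J1_sel [simp]:
  "btotal (J1 M E) = jets M E 1" "bproj (J1 M E) = fst" "brank (J1 M E) = (mdim M + 1) * brank E"
  by (simp_all add: J1_def)

lemma fibre_J1: "fibre (J1 M E) x = {jet M E 1 s x | s. local_section M E x s}"
  by (auto simp: fibre_def jets_def)

definition J1_triv ::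
  "'m::{t2_space, second_countable_topology} manifold \<Rightarrow> ('m, 'e, 'z) vbundle_scheme \<Rightarrow>
   'm chart \<Rightarrow> ('m, 'e) triv \<Rightarrow> ('m, ('m, 'e) jet) triv" where
  "J1_triv M E c T = (fst c \<inter> fst T, J1_coord M E c (snd T))"

lemma trivs_J1: "trivs (J1 M E) = {J1_triv M E c T | c T. c \<in> charts M \<and> T \<in> trivs E}"
  by (force simp: J1_def J1_triv_def)

text \<open>
  The induced coordinate of index \<open>b\<close> of the 1-jets of \<open>s\<close>, as a function of the base point.  It is
  computed from \<open>s\<close> itself, whereas \<open>J1_coord\<close> differentiates a chosen representative of each jet.
\<close>

definition section_coord ::
  "('m, 'e, 'z) vbundle_scheme \<Rightarrow> 'm chart \<Rightarrow> ('m, 'e) triv \<Rightarrow> ('m \<Rightarrow> 'e) \<Rightarrow> nat \<Rightarrow> 'm \<Rightarrow> real" where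
  "section_coord E c T s b x = (if b < brank E then snd T (s x) b
     else pd (b div brank E - 1) (in_chart c (\<lambda>z. snd T (s z) (b mod brank E))) (snd c x))"

context
  fixes M :: "'m::{t2_space, second_countable_topology} manifold" and E :: "('m, 'e, 'z) vbundle_scheme"
  assumes M: "smooth_manifold M" and E: "vector_bundle M E"
begin

lemma section_coord_cong_jet:
  assumes "same_jet M E 1 x s s'" "c \<in> charts M" "T \<in> trivs E" "x \<in> fst c" "x \<in> fst T"
    and b: "b < (mdim M + 1) * brank E"
  shows "section_coord E c T s b x = section_coord E c T s' b x"
proof -
  have "same_1jet_in M c x (\<lambda>x. snd T (s x) a) (\<lambda>x. snd T (s' x) a)" if "a < brank E" for a
    using assms that unfolding same_jet_1_iff[OF M] by blast
  from this[OF J1_index(1)[OF b]] show ?thesis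
    using J1_index(4,5)[OF b] unfolding same_1jet_in_def section_coord_def by auto
qed

text \<open>
  The chosen representative has the same 1-jet as \<open>s\<close>, and the coordinates depend on the 1-jet only.
\<close>

lemma J1_coord_jet:
  assumes s: "local_section M E x s" and "c \<in> charts M" "T \<in> trivs E" "x \<in> fst c" "x \<in> fst T"
  shows "J1_coord M E c (snd T) (jet M E 1 s x) b =
    (if b < (mdim M + 1) * brank E then section_coord E c T s b x else 0)"
proof (cases "b < (mdim M + 1) * brank E")
  case True
  let ?s = "jet_rep (jet M E 1 s x)"
  have "J1_coord M E c (snd T) (jet M E 1 s x) b = section_coord E c T ?s b x"
    using True J1_index(3,4)[OF True] in_chart_image[OF M assms(2,4), of "\<lambda>z. snd T (?s z) b"]
    unfolding J1_coord_def case_prod_unfold section_coord_def in_chart_def[abs_def] Let_def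
    by (auto simp: pds_def)
  also have "\<dots> = section_coord E c T s b x"
    by (rule section_coord_cong_jet[OF same_jet_sym[OF jet_rep_jet(2)[OF s]] assms(2-5) True])
  finally show ?thesis using True by simp
next
  case False
  then show ?thesis unfolding J1_coord_def case_prod_unfold Let_def by simp
qed

text \<open>
  Sums and multiples of jets are formed on representatives, which are smooth near the base point.
\<close>

lemma linear_fibres_J1: "linear_fibres (J1 M E)"
  unfolding linear_fibres_def
proof (intro allI ballI conjI)
  fix x \<xi> \<eta> k assume "\<xi> \<in> fibre (J1 M E) x"
  then obtain s where s: "\<xi> = jet M E 1 s x" "local_section M E x s" by (auto simp: fibre_J1)
  have r: "local_section M E x (jet_rep \<xi>)" "fst \<xi> = x" using jet_rep_jet(1)[OF s(2)] s(1) by simp_all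
  show "bscale (J1 M E) k \<xi> \<in> fibre (J1 M E) x"
    using local_section_sec_scale[OF M E r(1)] r(2) by (auto simp: J1_def fibre_def jets_def)
  assume "\<eta> \<in> fibre (J1 M E) x"
  then obtain s' where s': "\<eta> = jet M E 1 s' x" "local_section M E x s'" by (auto simp: fibre_J1)
  have r': "local_section M E x (jet_rep \<eta>)" using jet_rep_jet(1)[OF s'(2)] s'(1) by simp_all
  show "badd (J1 M E) \<xi> \<eta> \<in> fibre (J1 M E) x"
    using local_section_sec_add[OF M E r(1) r'] r(2) by (auto simp: J1_def fibre_def jets_def)
qed

context
  fixes c :: "'m chart" and T :: "('m, 'e) triv"
  assumes c: "c \<in> charts M" and T: "T \<in> trivs E"
begin

lemma section_coord_sec_add:
  assumes "local_section M E x s" "local_section M E x s'" "x \<in> fst c" "x \<in> fst T"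
    and b: "b < (mdim M + 1) * brank E"
  shows "section_coord E c T (sec_add E s s') b x = section_coord E c T s b x + section_coord E c T s' b x"
proof -
  obtain A where A: "open A" "x \<in> A" "A \<subseteq> fst T" "\<And>x. x \<in> A \<Longrightarrow> s x \<in> fibre E x"
    "\<And>a. a < brank E \<Longrightarrow> smooth_in M c A (\<lambda>x. snd T (s x) a)"
    by (rule local_sectionE[OF M E assms(1) T assms(4)]) (use c in blast)
  obtain B where B: "open B" "x \<in> B" "B \<subseteq> fst T" "\<And>x. x \<in> B \<Longrightarrow> s' x \<in> fibre E x"
    "\<And>a. a < brank E \<Longrightarrow> smooth_in M c B (\<lambda>x. snd T (s' x) a)"
    by (rule local_sectionE[OF M E assms(2) T assms(4)]) (use c in blast)
  have o: "open (A \<inter> B)" "x \<in> A \<inter> B" using A B by auto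
  let ?a = "b mod brank E" and ?i = "b div brank E - 1"
  note a = J1_index(1)[OF b]
  have eq: "snd T (sec_add E s s' z) a = snd T (s z) a + snd T (s' z) a" if "z \<in> A \<inter> B" for z a
    unfolding sec_add_def by (rule local_trivD(3)[OF local_triv_trivs[OF M E T], of z]) (use that A B in auto)
  show ?thesis
  proof (cases "b < brank E")
    case True
    then show ?thesis using eq[OF o(2)] by (simp add: section_coord_def)
  next
    case False
    note i = J1_index(5)[OF b False]
    have "pd ?i (in_chart c (\<lambda>z. snd T (sec_add E s s' z) ?a)) (snd c x) =
      pd ?i (in_chart c (\<lambda>z. snd T (s z) ?a + snd T (s' z) ?a)) (snd c x)"
      by (rule pd_in_chart_cong[OF M c o assms(3) eq i])
    also have "\<dots> = pd ?i (in_chart c (\<lambda>z. snd T (s z) ?a)) (snd c x) +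
        pd ?i (in_chart c (\<lambda>z. snd T (s' z) ?a)) (snd c x)"
      using smooth_in_subset[OF M c A(5)[OF a], of "A \<inter> B"] smooth_in_subset[OF M c B(5)[OF a], of "A \<inter> B"]
      by (intro pd_in_chart_add[OF M c _ _ assms(3) o(2) i]) auto
    finally show ?thesis using False by (simp add: section_coord_def)
  qed
qed

lemma section_coord_sec_scale:
  assumes "local_section M E x s" "x \<in> fst c" "x \<in> fst T"
    and b: "b < (mdim M + 1) * brank E"
  shows "section_coord E c T (sec_scale E (\<lambda>_. k) s) b x = k * section_coord E c T s b x"
proof -
  obtain A where A: "open A" "x \<in> A" "A \<subseteq> fst T" "\<And>x. x \<in> A \<Longrightarrow> s x \<in> fibre E x"
    "\<And>a. a < brank E \<Longrightarrow> smooth_in M c A (\<lambda>x. snd T (s x) a)"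
    by (rule local_sectionE[OF M E assms(1) T assms(3)]) (use c in blast)
  let ?a = "b mod brank E" and ?i = "b div brank E - 1"
  note a = J1_index(1)[OF b]
  have eq: "snd T (sec_scale E (\<lambda>_. k) s z) a = k * snd T (s z) a" if "z \<in> A" for z a
    unfolding sec_scale_def by (rule local_trivD(4)[OF local_triv_trivs[OF M E T], of z]) (use that A in auto)
  show ?thesis
  proof (cases "b < brank E")
    case True
    then show ?thesis using eq[OF A(2)] by (simp add: section_coord_def)
  next
    case False
    note i = J1_index(5)[OF b False]
    have "pd ?i (in_chart c (\<lambda>z. snd T (sec_scale E (\<lambda>_. k) s z) ?a)) (snd c x) =
      pd ?i (in_chart c (\<lambda>z. k * snd T (s z) ?a)) (snd c x)"
      by (rule pd_in_chart_cong[OF M c A(1,2) assms(2) eq i])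
    also have "\<dots> = k * pd ?i (in_chart c (\<lambda>z. snd T (s z) ?a)) (snd c x)"
    proof -
      have "pd ?i (in_chart c (\<lambda>_. k)) (snd c x) = 0" by (simp add: pd_def in_chart_def[abs_def])
      then show ?thesis
        using pd_in_chart_mult[OF M c smooth_in_const[OF M c] A(5)[OF a] assms(2) A(2) i, of k] by simp
    qed
    finally show ?thesis using False by (simp add: section_coord_def)
  qed
qed

text \<open>
  This makes the induced coordinates injective.  They determine the 1-jets of the components in one
  chart and one trivialisation.  The chain rule carries the agreement to every chart, and linearity to
  every trivialisation.
\<close>

lemma same_jet_if_section_coord:
  assumes s: "local_section M E x s" "local_section M E x s'" and x: "x \<in> fst c" "x \<in> fst T"
    and eq: "\<And>b. b < (mdim M + 1) * brank E \<Longrightarrow> section_coord E c T s b x = section_coord E c T s' b x"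
  shows "same_jet M E 1 x s s'"
proof -
  obtain A where A: "open A" "x \<in> A" "A \<subseteq> fst T" "\<And>x. x \<in> A \<Longrightarrow> s x \<in> fibre E x"
    "\<And>c a. c \<in> charts M \<Longrightarrow> a < brank E \<Longrightarrow> smooth_in M c A (\<lambda>x. snd T (s x) a)"
    using local_sectionE[OF M E s(1) T x(2)] by blast
  obtain B where B: "open B" "x \<in> B" "B \<subseteq> fst T" "\<And>x. x \<in> B \<Longrightarrow> s' x \<in> fibre E x"
    "\<And>c a. c \<in> charts M \<Longrightarrow> a < brank E \<Longrightarrow> smooth_in M c B (\<lambda>x. snd T (s' x) a)"
    using local_sectionE[OF M E s(2) T x(2)] by blast
  have agree: "same_1jet_in M c x (\<lambda>x. snd T (s x) a) (\<lambda>x. snd T (s' x) a)" if a: "a < brank E" for a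
    unfolding same_1jet_in_def
  proof (intro conjI allI impI)
    show "snd T (s x) a = snd T (s' x) a" using eq[of a] a by (simp add: section_coord_def)
    fix i assume i: "i < mdim M"
    \<comment> \<open>the index of the derivative in direction \<open>i\<close> of the component \<open>a\<close>\<close>
    let ?b = "(i + 1) * brank E + a"
    have "(i + 1) * brank E + a < (i + 1) * brank E + brank E" using a by simp
    also have "\<dots> = (i + 2) * brank E" by simp
    also have "\<dots> \<le> (mdim M + 1) * brank E" using i by (intro mult_le_mono1) simp
    finally have b: "?b < (mdim M + 1) * brank E" .
    have "?b div brank E = (i + 1) + a div brank E" using a by (intro div_mult_self3) simp
    moreover have "?b mod brank E = a mod brank E" by (rule mod_mult_self3)
    ultimately have "?b div brank E - 1 = i" "?b mod brank E = a" "\<not> ?b < brank E" using a by simp_all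
    then show "pd i (in_chart c (\<lambda>x. snd T (s x) a)) (snd c x) = pd i (in_chart c (\<lambda>x. snd T (s' x) a)) (snd c x)"
      using eq[OF b] unfolding section_coord_def by simp
  qed
  show ?thesis
    unfolding same_jet_1_iff[OF M]
  proof (intro ballI impI allI)
    fix c' T' a assume c': "c' \<in> charts M" "x \<in> fst c'" and T': "T' \<in> trivs E" "x \<in> fst T'"
      and a: "a < brank E"
    let ?C = "A \<inter> B \<inter> fst T'"
    have T'l: "local_triv E T'" by (rule local_triv_trivs[OF M E T'(1)])
    have C: "open ?C" "x \<in> ?C" "?C \<subseteq> fst T \<inter> fst T'" using A B T' local_trivD(1)[OF T'l] by auto
    have sm: "smooth_in M d ?C (\<lambda>x. snd T (s x) a)" "smooth_in M d ?C (\<lambda>x. snd T (s' x) a)"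
      if "d \<in> charts M" "a < brank E" for d a
      using that smooth_in_subset[OF M that(1) A(5)[OF that], of ?C]
        smooth_in_subset[OF M that(1) B(5)[OF that], of ?C] by auto
    have "same_1jet_in M c' x (\<lambda>x. snd T (s x) a) (\<lambda>x. snd T (s' x) a)" if a: "a < brank E" for a
      by (rule same_1jet_in_change_of_chart[OF M c c'(1) C(1,2) x(1) c'(2) sm[OF c a] agree[OF a]])
    then show "same_1jet_in M c' x (\<lambda>x. snd T' (s x) a) (\<lambda>x. snd T' (s' x) a)"
      using A(4) B(4) sm[OF c'(1)]
      by (intro same_1jet_in_change_of_triv[OF M c'(1) vector_bundle_linear_fibres[OF E]
        local_triv_trivs[OF M E T] T'l smooth_transition_trivs[OF M E T T'(1)] C(1,3,2) c'(2)] a) auto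
  qed
qed

text \<open>
  This makes the induced coordinates surjective: the section whose components are affine functions of the
  chart coordinates, with the prescribed values and slopes at \<open>x\<close>.
\<close>

lemma section_with_coord:
  assumes x: "x \<in> fst c" "x \<in> fst T"
  obtains s where "local_section M E x s"
    "\<And>b. b < (mdim M + 1) * brank E \<Longrightarrow> section_coord E c T s b x = v b"
proof -
  define r where "r = brank E"
  define w where "w z a = (if a < r then v a + (\<Sum>j<mdim M. v ((j + 1) * r + a) * (snd c z j + - snd c x j)) else 0)"
    for z a
  define s where "s z = inv_into (fibre E z) (snd T) (w z)" for z
  let ?B = "fst c \<inter> fst T"
  have Tl: "local_triv E T" by (rule local_triv_trivs[OF M E T])
  have B: "open ?B" "x \<in> ?B" using chart_homeomorphism(1)[OF M c] local_trivD(1)[OF Tl] x by auto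
  have s: "s z \<in> fibre E z" "snd T (s z) = w z" if "z \<in> fst T" for z
    using local_triv_inv[OF Tl that, of "w z"]
    by (auto simp: s_def w_def r_def topspace_Euclidean_space)
  have w: "smooth_in M d ?B (\<lambda>z. w z a)" if d: "d \<in> charts M" for d a
  proof (cases "a < r")
    case True
    have "smooth_in M d ?B (\<lambda>z. snd c z j)" if "j < mdim M" for j
      using smooth_fun_on_chart_coordinate[OF M c that] d smooth_in_subset[OF M d]
      unfolding smooth_fun_on_iff by blast
    then have "smooth_in M d ?B (\<lambda>z. v a + (\<Sum>j<mdim M. v ((j + 1) * r + a) * (snd c z j + - snd c x j)))"
      by (intro smooth_in_add[OF M d B(1)] smooth_in_sum[OF M d B(1)] smooth_in_mult[OF M d B(1)]
          smooth_in_const[OF M d])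
    then show ?thesis using True by (simp add: w_def)
  next
    case False
    then show ?thesis by (simp add: w_def smooth_in_const[OF M d])
  qed
  show ?thesis
  proof (rule that)
    have "smooth_section_on M E ?B s"
      unfolding smooth_section_on_iff
    proof (intro conjI ballI allI impI)
      fix T' a d assume T': "T' \<in> trivs E" and a: "a < brank E" and d: "d \<in> charts M"
      have T'l: "local_triv E T'" by (rule local_triv_trivs[OF M E T'])
      let ?C = "fst T' \<inter> ?B"
      have C: "open ?C" "?C \<subseteq> fst T \<inter> fst T'" using B local_trivD(1)[OF T'l] by auto
      show "smooth_in M d ?C (\<lambda>x. snd T' (s x) a)"
      proof (rule smooth_in_change_of_triv[OF M d vector_bundle_linear_fibres[OF E] Tl T'l
            smooth_transition_trivs[OF M E T T'] C _ _ a])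
        show "smooth_in M d ?C (\<lambda>x. snd T (s x) b)" for b
          by (rule smooth_in_cong[OF M d C(1) smooth_in_subset[OF M d w[OF d, of b]]])
            (use s(2) in auto)
      qed (use s in auto)
    qed (use s in auto)
    then show "local_section M E x s" unfolding local_section_def using B by blast
  next
    fix b assume b: "b < (mdim M + 1) * brank E"
    show "section_coord E c T s b x = v b"
    proof (cases "b < r")
      case True
      then show ?thesis using s(2)[OF x(2)] by (simp add: section_coord_def r_def[symmetric] w_def)
    next
      case False
      let ?a = "b mod r" and ?i = "b div r - 1"
      let ?p = "snd c x"
      have a: "?a < r" using J1_index(1)[OF b] r_def by simp
      have i: "?i < mdim M" using J1_index(5)[OF b] False r_def by simp
      have "b div r \<noteq> 0" using J1_index(3)[OF b] False r_def by simp
      then have bi: "(?i + 1) * r + ?a = b" by simp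
      have "pd ?i (in_chart c (\<lambda>z. snd T (s z) ?a)) ?p =
          pd ?i (\<lambda>y. v ?a + (\<Sum>j<mdim M. v ((j + 1) * r + ?a) * (y j + - ?p j))) ?p"
        by (rule pd_cong[OF open_chart_image[OF M c B(1)] _ i])
          (use x s(2) a in \<open>auto simp: in_chart_image[OF M c] w_def\<close>)
      also have "\<dots> = v b"
        unfolding pd_def
      proof (rule DERIV_imp_deriv)
        \<comment> \<open>on the coordinate line in direction \<open>?i\<close> only one summand varies and the others vanish\<close>
        have eq: "(\<Sum>j<mdim M. v ((j + 1) * r + ?a) * ((?p(?i := t)) j + - ?p j)) = v b * (t - ?p ?i)" for t
        proof -
          have "(\<Sum>j<mdim M. v ((j + 1) * r + ?a) * ((?p(?i := t)) j + - ?p j)) =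
            (\<Sum>j<mdim M. if j = ?i then v ((?i + 1) * r + ?a) * (t - ?p ?i) else 0)"
            by (rule sum.cong) auto
          also have "\<dots> = v b * (t - ?p ?i)" using i bi by (simp only: sum.delta finite_lessThan lessThan_iff if_True)
          finally show ?thesis .
        qed
        show "((\<lambda>t. v ?a + (\<Sum>j<mdim M. v ((j + 1) * r + ?a) * ((?p(?i := t)) j + - ?p j)))
          has_real_derivative v b) (at (?p ?i))"
          unfolding eq by (auto intro!: derivative_eq_intros)
      qed
      finally show ?thesis using False by (simp add: section_coord_def r_def[symmetric])
    qed
  qed
qed

text \<open>
  Partial derivatives are additive and homogeneous, so the induced coordinates are linear; that they are
  bijective on the fibres is the content of \<open>same_jet_if_section_coord\<close> and \<open>section_with_coord\<close>.
\<close>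

lemma local_triv_J1: "local_triv (J1 M E) (J1_triv M E c T)"
proof -
  let ?N = "(mdim M + 1) * brank E" and ?\<tau> = "J1_coord M E c (snd T)"
  have "open (fst c \<inter> fst T)"
    using chart_homeomorphism(1)[OF M c] local_trivD(1)[OF local_triv_trivs[OF M E T]] by blast
  moreover have "bij_betw ?\<tau> (fibre (J1 M E) x) (Rn ?N) \<and>
      (\<forall>\<xi>\<in>fibre (J1 M E) x. \<forall>\<eta>\<in>fibre (J1 M E) x. ?\<tau> (badd (J1 M E) \<xi> \<eta>) = (\<lambda>b. ?\<tau> \<xi> b + ?\<tau> \<eta> b)) \<and>
      (\<forall>k. \<forall>\<xi>\<in>fibre (J1 M E) x. ?\<tau> (bscale (J1 M E) k \<xi>) = (\<lambda>b. k * ?\<tau> \<xi> b))"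
    if x: "x \<in> fst c" "x \<in> fst T" for x
  proof -
    note coord = J1_coord_jet[OF _ c T x]
    have rep: "local_section M E x (jet_rep \<xi>) \<and> fst \<xi> = x \<and> jet M E 1 (jet_rep \<xi>) x = \<xi>"
      if \<xi>: "\<xi> \<in> fibre (J1 M E) x" for \<xi>
    proof -
      obtain s where s: "\<xi> = jet M E 1 s x" "local_section M E x s" using \<xi> by (auto simp: fibre_J1)
      then show ?thesis using jet_rep_jet[OF s(2), of 1] jet_eqI by fastforce
    qed
    have "inj_on ?\<tau> (fibre (J1 M E) x)"
    proof (rule inj_onI)
      fix \<xi> \<eta> assume \<xi>: "\<xi> \<in> fibre (J1 M E) x" and \<eta>: "\<eta> \<in> fibre (J1 M E) x" and eq: "?\<tau> \<xi> = ?\<tau> \<eta>"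
      have "section_coord E c T (jet_rep \<xi>) b x = section_coord E c T (jet_rep \<eta>) b x" if "b < ?N" for b
        using coord[of "jet_rep \<xi>" b] coord[of "jet_rep \<eta>" b] rep[OF \<xi>] rep[OF \<eta>] eq that by simp
      then have "same_jet M E 1 x (jet_rep \<xi>) (jet_rep \<eta>)"
        using rep[OF \<xi>] rep[OF \<eta>] x by (intro same_jet_if_section_coord) auto
      from jet_eqI[OF this] show "\<xi> = \<eta>" using rep[OF \<xi>] rep[OF \<eta>] by simp
    qed
    moreover have "?\<tau> ` fibre (J1 M E) x = Rn ?N"
    proof
      show "?\<tau> ` fibre (J1 M E) x \<subseteq> Rn ?N"
        using coord by (auto simp: fibre_J1 topspace_Euclidean_space)
      show "Rn ?N \<subseteq> ?\<tau> ` fibre (J1 M E) x"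
      proof
        fix v assume v: "v \<in> Rn ?N"
        obtain s where s: "local_section M E x s" "\<And>b. b < ?N \<Longrightarrow> section_coord E c T s b x = v b"
          using section_with_coord[OF x] by blast
        have "?\<tau> (jet M E 1 s x) = v"
          using coord[OF s(1)] s(2) v by (auto simp: fun_eq_iff topspace_Euclidean_space)
        then show "v \<in> ?\<tau> ` fibre (J1 M E) x" using s(1) by (auto simp: fibre_J1)
      qed
    qed
    moreover have "?\<tau> (badd (J1 M E) \<xi> \<eta>) = (\<lambda>b. ?\<tau> \<xi> b + ?\<tau> \<eta> b)"
      if \<xi>: "\<xi> \<in> fibre (J1 M E) x" and \<eta>: "\<eta> \<in> fibre (J1 M E) x" for \<xi> \<eta>
    proof
      have l: "local_section M E x (jet_rep \<xi>)" "local_section M E x (jet_rep \<eta>)"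
        using rep[OF \<xi>] rep[OF \<eta>] by auto
      fix b
      have "?\<tau> (badd (J1 M E) \<xi> \<eta>) b = ?\<tau> (jet M E 1 (sec_add E (jet_rep \<xi>) (jet_rep \<eta>)) x) b"
        using rep[OF \<xi>] by (simp add: J1_def)
      also have "\<dots> = ?\<tau> (jet M E 1 (jet_rep \<xi>) x) b + ?\<tau> (jet M E 1 (jet_rep \<eta>) x) b"
        using coord[OF local_section_sec_add[OF M E l]] coord[OF l(1)] coord[OF l(2)]
          section_coord_sec_add[OF l x] by simp
      finally show "?\<tau> (badd (J1 M E) \<xi> \<eta>) b = ?\<tau> \<xi> b + ?\<tau> \<eta> b"
        using rep[OF \<xi>] rep[OF \<eta>] by simp
    qed
    moreover have "?\<tau> (bscale (J1 M E) k \<xi>) = (\<lambda>b. k * ?\<tau> \<xi> b)"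
      if \<xi>: "\<xi> \<in> fibre (J1 M E) x" for k \<xi>
    proof
      have l: "local_section M E x (jet_rep \<xi>)" using rep[OF \<xi>] by auto
      fix b
      have "?\<tau> (bscale (J1 M E) k \<xi>) b = ?\<tau> (jet M E 1 (sec_scale E (\<lambda>_. k) (jet_rep \<xi>)) x) b"
        using rep[OF \<xi>] by (simp add: J1_def)
      also have "\<dots> = k * ?\<tau> (jet M E 1 (jet_rep \<xi>) x) b"
        using coord[OF local_section_sec_scale[OF M E l]] coord[OF l] section_coord_sec_scale[OF l x] by simp
      finally show "?\<tau> (bscale (J1 M E) k \<xi>) b = k * ?\<tau> \<xi> b" using rep[OF \<xi>] by simp
    qed
    ultimately show ?thesis by (auto simp: bij_betw_def)
  qed
  ultimately show ?thesis unfolding local_triv_def J1_triv_def prod.case J1_sel by blast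
qed

end

end

section \<open>Sections of subbundles\<close>

lemma fibre_sub_bundle: "fibre (sub_bundle M F g) x = {e \<in> g. bproj F e = x}"
  by (simp add: fibre_def sub_bundle_def)

lemma sub_bundle_sel:
  "brank (sub_bundle M F g) = subbundle_rank M F g"
  "trivs (sub_bundle M F g) = {T. adapted_triv M F (subbundle_rank M F g) g T}"
  by (simp_all add: sub_bundle_def)

lemma subbundle_rank_works: "subbundle M F g \<Longrightarrow> subbundle_of_rank M F (subbundle_rank M F g) g"
  unfolding subbundle_def subbundle_rank_def by (rule someI_ex)

lemma adapted_trivD:
  assumes "adapted_triv M F k g T"
  shows "local_triv F T" "T' \<in> trivs F \<Longrightarrow> smooth_transition M F T T'"
    "T' \<in> trivs F \<Longrightarrow> smooth_transition M F T' T"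
    "x \<in> fst T \<Longrightarrow> e \<in> fibre F x \<Longrightarrow> e \<in> g \<Longrightarrow> snd T e \<in> Rn k"
  using assms unfolding adapted_triv_def by blast+

text \<open>
  The inclusion \<open>J\<^sup>1g \<rightarrow> J\<^sup>1F\<close> is well defined on classes.  In an adapted trivialisation the coordinates
  below the rank of \<open>g\<close> agree to first order by hypothesis, and the remaining ones vanish identically on
  sections of \<open>g\<close>.  Passing to a trivialisation of \<open>F\<close> preserves the agreement.
\<close>

lemma same_jet_in_ambient_bundle:
  assumes M: "smooth_manifold M" and F: "linear_fibres F" "\<And>T. T \<in> trivs F \<Longrightarrow> local_triv F T"
    and g: "subbundle M F g"
    and s: "local_section M (sub_bundle M F g) m s" "local_section M (sub_bundle M F g) m s'"
    and jet: "same_jet M (sub_bundle M F g) 1 m s s'"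
  shows "same_jet M F 1 m s s'"
proof -
  define k where "k = subbundle_rank M F g"
  have gk: "g \<subseteq> btotal F" "\<And>x. \<exists>T. adapted_triv M F k g T \<and> x \<in> fst T"
    using subbundle_rank_works[OF g] unfolding subbundle_of_rank_def k_def by blast+
  obtain T where T: "adapted_triv M F k g T" "m \<in> fst T" using gk(2) by blast
  have TG: "T \<in> trivs (sub_bundle M F g)" using T(1) by (simp add: sub_bundle_sel k_def)
  note Tl = adapted_trivD(1)[OF T(1)]
  obtain A where A: "open A" "m \<in> A" "smooth_section_on M (sub_bundle M F g) A s"
    using s(1) unfolding local_section_def by blast
  obtain B where B: "open B" "m \<in> B" "smooth_section_on M (sub_bundle M F g) B s'"
    using s(2) unfolding local_section_def by blast
  have fib: "u x \<in> fibre F x" "u x \<in> g" if "smooth_section_on M (sub_bundle M F g) D u" "x \<in> D" for D u x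
    using that gk(1) unfolding smooth_section_on_def fibre_sub_bundle by (auto simp: fibre_def)
  have zero: "snd T (u x) b = 0"
    if "smooth_section_on M (sub_bundle M F g) D u" "x \<in> D" "x \<in> fst T" "\<not> b < k" for D u x b
    using adapted_trivD(4)[OF T(1) that(3) fib[OF that(1,2)]] that(4)
    by (simp add: topspace_Euclidean_space)
  show ?thesis
    unfolding same_jet_1_iff[OF M]
  proof (intro ballI impI allI)
    fix c T' a assume c: "c \<in> charts M" "m \<in> fst c" and T': "T' \<in> trivs F" "m \<in> fst T'" and a: "a < brank F"
    define C where "C = fst T \<inter> fst T' \<inter> A \<inter> B"
    have C: "open C" "C \<subseteq> fst T \<inter> fst T'" "m \<in> C"
      using A B T T' local_trivD(1)[OF Tl] local_trivD(1)[OF F(2)[OF T'(1)]] by (auto simp: C_def)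
    have sm: "smooth_in M c C (\<lambda>x. snd T (u x) b)"
      if u: "smooth_section_on M (sub_bundle M F g) D u" and D: "C \<subseteq> D" for D u b
    proof (cases "b < k")
      case True
      then have "smooth_in M c (fst T \<inter> D) (\<lambda>x. snd T (u x) b)"
        using u c(1) TG unfolding smooth_section_on_iff sub_bundle_sel(1) k_def by blast
      then show ?thesis by (rule smooth_in_subset[OF M c(1)]) (use C D in auto)
    next
      case False
      show ?thesis
        by (rule smooth_in_cong[OF M c(1) C(1) smooth_in_const[OF M c(1), where k = 0]])
          (use zero[OF u _ _ False] C D in auto)
    qed
    have CAB: "C \<subseteq> A" "C \<subseteq> B" by (auto simp: C_def)
    have ag: "same_1jet_in M c m (\<lambda>x. snd T (s x) b) (\<lambda>x. snd T (s' x) b)" for b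
    proof (cases "b < k")
      case True
      then show ?thesis
        using jet c TG T(2) unfolding same_jet_1_iff[OF M] sub_bundle_sel(1) k_def by blast
    next
      case False
      have "same_1jet_in M c m (\<lambda>_. 0) (\<lambda>_. 0)" by (simp add: same_1jet_in_def)
      then show ?thesis
        by (rule same_1jet_in_cong[OF M c(1) C(1,3) c(2), rotated 2])
          (rule zero[OF A(3) _ _ False, symmetric] zero[OF B(3) _ _ False, symmetric];
            use C CAB in blast)+
    qed
    show "same_1jet_in M c m (\<lambda>x. snd T' (s x) a) (\<lambda>x. snd T' (s' x) a)"
      by (rule same_1jet_in_change_of_triv[OF M c(1) F(1) Tl F(2)[OF T'(1)] adapted_trivD(2)[OF T(1) T'(1)]
            C c(2) _ _ sm[OF A(3) CAB(1)] sm[OF B(3) CAB(2)] ag a])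
        (use fib[OF A(3)] fib[OF B(3)] CAB in auto)
  qed
qed

context
  fixes M :: "'m::{t2_space, second_countable_topology} manifold" and E :: "('m, 'e, 'z) vbundle_scheme"
  assumes M: "smooth_manifold M" and E: "vector_bundle M E"
begin

lemma trivs_J1_local: "T' \<in> trivs (J1 M E) \<Longrightarrow> local_triv (J1 M E) T'"
  using local_triv_J1[OF M E] by (auto simp: trivs_J1)

lemma smooth_section_on_local_section: "smooth_section_on M E A s \<Longrightarrow> open A \<Longrightarrow> x \<in> A \<Longrightarrow> local_section M E x s"
  unfolding local_section_def by blast

context
  fixes c :: "'m chart" and T :: "('m, 'e) triv"
  assumes c: "c \<in> charts M" and T: "T \<in> trivs E"
begin

lemma in_chart_section_coord:
  assumes "x \<in> fst c" "b < (mdim M + 1) * brank E"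
  shows "in_chart c (section_coord E c T s b) (snd c x) =
    pds (if b < brank E then [] else [b div brank E - 1]) (in_chart c (\<lambda>x. snd T (s x) (b mod brank E))) (snd c x)"
  using in_chart_image[OF M c assms(1)] J1_index(4)[OF assms(2)]
  by (simp add: section_coord_def pds_def)

text \<open>
  A partial derivative of a smooth function is smooth in the chart used for differentiating.
\<close>

lemma smooth_in_section_coord:
  assumes s: "smooth_section_on M E A s" "open A" and b: "b < (mdim M + 1) * brank E"
  shows "smooth_in M c (fst c \<inter> fst T \<inter> A) (section_coord E c T s b)"
proof -
  let ?B = "fst c \<inter> fst T \<inter> A" and ?f = "in_chart c (\<lambda>x. snd T (s x) (b mod brank E))"
  have B: "open ?B"
    using s(2) chart_homeomorphism(1)[OF M c] local_trivD(1)[OF local_triv_trivs[OF M E T]] by blast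
  have "smooth_in M c (fst T \<inter> A) (\<lambda>x. snd T (s x) (b mod brank E))"
    using s(1) c T J1_index(1)[OF b] unfolding smooth_section_on_iff by blast
  then have "smooth_in M c ?B (\<lambda>x. snd T (s x) (b mod brank E))"
    by (rule smooth_in_subset[OF M c]) auto
  then have f: "Cinf (mdim M) (snd c ` (fst c \<inter> ?B)) ?f" unfolding smooth_in_def .
  then have "Cinf (mdim M) (snd c ` (fst c \<inter> ?B)) (pds (if b < brank E then [] else [b div brank E - 1]) ?f)"
    using Cinf_pd[OF f J1_index(5)[OF b]] by (auto simp: pds_def)
  then show ?thesis
    unfolding smooth_in_def
    by (rule Cinf_cong[OF open_chart_image[OF M c B]]) (use in_chart_section_coord[OF _ b] in auto)
qed

lemma J1_triv_prolongation:
  assumes "smooth_section_on M E A s" "open A" "b < (mdim M + 1) * brank E" "x \<in> fst c \<inter> fst T \<inter> A"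
  shows "snd (J1_triv M E c T) (jet M E 1 s x) b = section_coord E c T s b x"
  using J1_coord_jet[OF M E smooth_section_on_local_section[OF assms(1,2)] c T, of x b] assms
  by (simp add: J1_triv_def)

lemma smooth_in_prolongation:
  assumes "smooth_section_on M E A s" "open A" "b < (mdim M + 1) * brank E"
  shows "smooth_in M c (fst c \<inter> fst T \<inter> A) (\<lambda>x. snd (J1_triv M E c T) (jet M E 1 s x) b)"
proof (rule smooth_in_cong[OF M c _ smooth_in_section_coord[OF assms]])
  show "open (fst c \<inter> fst T \<inter> A)"
    using assms(2) chart_homeomorphism(1)[OF M c] local_trivD(1)[OF local_triv_trivs[OF M E T]] by blast
qed (rule J1_triv_prolongation[OF assms, symmetric], blast)

end

text \<open>
  The inclusion \<open>J\<^sup>2E \<rightarrow> J\<^sup>1(J\<^sup>1E)\<close> is well defined on classes.  In the chart \<open>c\<close> of the induced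
  trivialisation, first derivatives of the induced coordinates are derivatives of order at most 2 of the
  components.  The 1-jet in another chart \<open>c'\<close> follows by the chain rule.
\<close>

lemma same_jet_prolongation:
  assumes s: "local_section M E m s" and s': "local_section M E m s'" and jet: "same_jet M E 2 m s s'"
  shows "same_jet M (J1 M E) 1 m (jet M E 1 s) (jet M E 1 s')"
  unfolding same_jet_1_iff[OF M]
proof (intro ballI impI allI)
  fix c' T' b
  assume c': "c' \<in> charts M" "m \<in> fst c'" and T': "T' \<in> trivs (J1 M E)" "m \<in> fst T'" and "b < brank (J1 M E)"
  then have b: "b < (mdim M + 1) * brank E" by simp
  obtain c T where c: "c \<in> charts M" and T: "T \<in> trivs E" and eq: "T' = J1_triv M E c T"
    using T'(1) by (auto simp: trivs_J1)
  have m: "m \<in> fst c" "m \<in> fst T" using T'(2) by (auto simp: eq J1_triv_def)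
  obtain A where A: "open A" "m \<in> A" "smooth_section_on M E A s"
    using s unfolding local_section_def by blast
  obtain B where B: "open B" "m \<in> B" "smooth_section_on M E B s'"
    using s' unfolding local_section_def by blast
  let ?C = "fst c \<inter> fst T \<inter> (A \<inter> B)"
  have C: "open ?C" "m \<in> ?C"
    using A B m chart_homeomorphism(1)[OF M c] local_trivD(1)[OF local_triv_trivs[OF M E T]] by auto
  let ?js = "if b < brank E then [] else [b div brank E - 1]"
  let ?f = "\<lambda>s. in_chart c (\<lambda>x. snd T (s x) (b mod brank E))"
  have js: "?js \<in> lists {..<mdim M}" "length ?js \<le> 1" using J1_index(5)[OF b] by auto
  have jets: "pds ks (?f s) (snd c m) = pds ks (?f s') (snd c m)"
    if "ks \<in> lists {..<mdim M}" "length ks \<le> 2" for ks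
    using jet that c T m J1_index(1)[OF b] unfolding same_jet_in_charts by blast
  have coord: "same_1jet_in M c m (section_coord E c T s b) (section_coord E c T s' b)"
    unfolding same_1jet_in_def
  proof (intro conjI allI impI)
    show "section_coord E c T s b m = section_coord E c T s' b m"
      using in_chart_section_coord[OF c T m(1) b, of s] in_chart_section_coord[OF c T m(1) b, of s']
        in_chart_image[OF M c m(1)] jets[OF js(1)] js(2) by simp
    fix i assume i: "i < mdim M"
    have pd: "pd i (in_chart c (section_coord E c T u b)) (snd c m) = pds (i # ?js) (?f u) (snd c m)" for u
    proof -
      have "pd i (in_chart c (section_coord E c T u b)) (snd c m) = pd i (pds ?js (?f u)) (snd c m)"
        by (rule pd_cong[OF open_chart_image[OF M c C(1)] _ i])
          (use C m in_chart_section_coord[OF c T _ b] in auto)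
      then show ?thesis by (simp add: pds_def)
    qed
    show "pd i (in_chart c (section_coord E c T s b)) (snd c m) =
        pd i (in_chart c (section_coord E c T s' b)) (snd c m)"
      unfolding pd by (rule jets) (use js i in auto)
  qed
  have "same_1jet_in M c m (\<lambda>x. snd T' (jet M E 1 s x) b) (\<lambda>x. snd T' (jet M E 1 s' x) b)"
    unfolding eq
    by (rule same_1jet_in_cong[OF M c C m(1) _ _ coord])
      (rule J1_triv_prolongation[OF c T A(3,1) b, symmetric] J1_triv_prolongation[OF c T B(3,1) b, symmetric]; blast)+
  moreover have "smooth_in M c ?C (\<lambda>x. snd T' (jet M E 1 s x) b)" "smooth_in M c ?C (\<lambda>x. snd T' (jet M E 1 s' x) b)"
    using smooth_in_prolongation[OF c T A(3,1) b] smooth_in_prolongation[OF c T B(3,1) b]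
    unfolding eq by (auto intro: smooth_in_subset[OF M c])
  ultimately show "same_1jet_in M c' m (\<lambda>x. snd T' (jet M E 1 s x) b) (\<lambda>x. snd T' (jet M E 1 s' x) b)"
    using same_1jet_in_change_of_chart[OF M c c'(1) C m(1) c'(2)] by blast
qed

text \<open>
  Smoothness in the adapted trivialisations is tested in each chart \<open>c\<close> separately.  Near each point it is
  compared with a trivialisation of \<open>J\<^sup>1E\<close> that is induced by the same chart \<open>c\<close>, where the coordinates of
  \<open>J\<^sup>1W\<close> are known to be smooth.
\<close>

lemma prolongation_in_sub_bundle:
  assumes W: "W \<in> sections M E" and g: "subbundle M (J1 M E) g" and jet: "\<And>x. jet M E 1 W x \<in> g"
  shows "jet M E 1 W \<in> sections M (sub_bundle M (J1 M E) g)"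
proof -
  define k where "k = subbundle_rank M (J1 M E) g"
  have k: "k \<le> brank (J1 M E)"
    using subbundle_rank_works[OF g] unfolding subbundle_of_rank_def k_def by blast
  have Ws: "smooth_section_on M E UNIV W" using W by (simp add: sections_def)
  have fib: "jet M E 1 W x \<in> fibre (J1 M E) x" for x
    using smooth_section_on_local_section[OF Ws] by (auto simp: fibre_J1)
  have "smooth_section_on M (sub_bundle M (J1 M E) g) UNIV (jet M E 1 W)"
    unfolding smooth_section_on_iff
  proof (intro conjI ballI allI impI)
    show "jet M E 1 W x \<in> fibre (sub_bundle M (J1 M E) g) x" for x
      using jet by (simp add: fibre_sub_bundle)
    fix T a c assume "T \<in> trivs (sub_bundle M (J1 M E) g)" and "a < brank (sub_bundle M (J1 M E) g)"
      and c: "c \<in> charts M"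
    then have T: "adapted_triv M (J1 M E) k g T" and a: "a < brank (J1 M E)"
      using k by (auto simp: sub_bundle_sel k_def)
    note Tl = adapted_trivD(1)[OF T]
    show "smooth_in M c (fst T \<inter> UNIV) (\<lambda>x. snd T (jet M E 1 W x) a)"
    proof (rule smooth_in_local[OF M c])
      show "open (fst T \<inter> UNIV)" using local_trivD(1)[OF Tl] by simp
      fix x assume x: "x \<in> fst c" "x \<in> fst T \<inter> UNIV"
      obtain T0 where T0: "T0 \<in> trivs E" "x \<in> fst T0"
        using E unfolding vector_bundle_def case_prod_unfold by blast
      let ?B = "fst c \<inter> fst T0 \<inter> fst T"
      have B: "open ?B" "x \<in> ?B"
        using x T0 chart_homeomorphism(1)[OF M c] local_trivD(1)[OF local_triv_trivs[OF M E T0(1)]] local_trivD(1)[OF Tl]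
        by auto
      have J: "J1_triv M E c T0 \<in> trivs (J1 M E)" using c T0 unfolding trivs_J1 by blast
      have "smooth_in M c ?B (\<lambda>x. snd T (jet M E 1 W x) a)"
      proof (rule smooth_in_change_of_triv[OF M c linear_fibres_J1[OF M E] trivs_J1_local[OF J] Tl
            adapted_trivD(3)[OF T J] B(1) _ fib _ a])
        show "?B \<subseteq> fst (J1_triv M E c T0) \<inter> fst T" by (auto simp: J1_triv_def)
        show "smooth_in M c ?B (\<lambda>x. snd (J1_triv M E c T0) (jet M E 1 W x) b)" if "b < brank (J1 M E)" for b
          using smooth_in_prolongation[OF c T0(1) Ws open_UNIV] that
          by (auto intro: smooth_in_subset[OF M c])
      qed
      then show "\<exists>B. open B \<and> x \<in> B \<and> smooth_in M c B (\<lambda>x. snd T (jet M E 1 W x) a)" using B by blast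
    qed
  qed
  then show ?thesis by (simp add: sections_def)
qed

end

section \<open>Symmetries and the prolongation\<close>

text \<open>
  The Lie algebroid \<open>J\<^sup>1A\<close> extends the vector bundle \<open>J\<^sup>1A\<close> by an anchor and a bracket, which do not
  occur in the notion of a subbundle.
\<close>

lemma subbundle_J1_algebroid: "subbundle M (J1_algebroid M A) g \<longleftrightarrow> subbundle M (J1 M A) g"
  unfolding subbundle_def subbundle_of_rank_def adapted_triv_def local_triv_def smooth_transition_def
    fibre_def J1_algebroid_def J1_with_def
  by (simp add: vbundle.defs algebroid.defs)

theorem proposition2p2:
  fixes M :: "'m::{t2_space, second_countable_topology} manifold"
    and t :: "('m, 'e) algebroid"
    and g :: "('m, 'e) jet set"
    and W :: "'m \<Rightarrow> 'e"
  assumes "smooth_manifold M"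
    and "lie_algebroid M t"
    and "inf_geometric_structure M t g"
    and "W \<in> sections M t"
  shows "is_symmetry M t g W \<longleftrightarrow>
     jet M t 1 W \<in> sections M (sub_bundle M (J1 M t) g) \<and>
     is_symmetry M (sub_bundle M (J1 M t) g) (prolongation M t g) (jet M t 1 W)"
proof
  note M = assms(1)
  have t: "vector_bundle M t" using assms(2) by (simp add: lie_algebroid_def)
  have g: "subbundle M (J1 M t) g"
    using assms(3) by (simp add: inf_geometric_structure_def subalgebroid_def subbundle_J1_algebroid)
  let ?F = "J1 M t" and ?\<sigma> = "jet M t 1 W"
  let ?G = "sub_bundle M ?F g"
  {
    assume "is_symmetry M t g W"
    then have \<sigma>: "?\<sigma> \<in> sections M ?G"
      by (intro prolongation_in_sub_bundle[OF M t assms(4) g]) (simp add: is_symmetry_def)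
    have \<sigma>l: "local_section M ?G m ?\<sigma>" for m
      using \<sigma> by (auto simp: sections_def local_section_def)
    have Wl: "local_section M t m W" for m
      using assms(4) by (auto simp: sections_def local_section_def)
    have "jet M ?G 1 ?\<sigma> m \<in> prolongation M t g" for m
    proof -
      let ?s = "jet_rep (jet M ?G 1 ?\<sigma> m)" and ?w = "jet_rep (jet M t 2 W m)"
      have "same_jet M ?F 1 m ?\<sigma> ?s"
        using jet_rep_jet[OF \<sigma>l[of m], of 1] trivs_J1_local[OF M t]
        by (intro same_jet_in_ambient_bundle[OF M linear_fibres_J1[OF M t] _ g \<sigma>l]) auto
      \<comment> \<open>\<open>?s\<close> and \<open>?w\<close> are the representatives chosen by the two inclusions; both give the class of \<open>\<sigma>\<close>\<close>
      moreover have "same_jet M ?F 1 m ?\<sigma> (jet M t 1 ?w)"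
        using jet_rep_jet[OF Wl[of m], of 2] by (intro same_jet_prolongation[OF M t Wl]) auto
      ultimately have "jet M ?F 1 ?s m = jet M ?F 1 (jet M t 1 ?w) m"
        using jet_eqI same_jet_sym same_jet_trans by metis
      then have "J1_sub_inclusion M ?F (jet M ?G 1 ?\<sigma> m) = J2_inclusion M t (jet M t 2 W m)"
        by (simp add: J1_sub_inclusion_def J2_inclusion_def)
      moreover have "jet M t 2 W m \<in> jets M t 2" using Wl by (auto simp: jets_def)
      moreover have "jet M ?G 1 ?\<sigma> m \<in> jets M ?G 1" using \<sigma>l by (auto simp: jets_def)
      ultimately show ?thesis unfolding prolongation_def by blast
    qed
    then show "?\<sigma> \<in> sections M ?G \<and> is_symmetry M ?G (prolongation M t g) ?\<sigma>"
      using \<sigma> by (simp add: is_symmetry_def)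
  next
    assume "?\<sigma> \<in> sections M ?G \<and> is_symmetry M ?G (prolongation M t g) ?\<sigma>"
    then have "?\<sigma> m \<in> fibre ?G m" for m by (simp add: sections_def smooth_section_on_def)
    then show "is_symmetry M t g W"
      using assms(4) by (simp add: is_symmetry_def fibre_sub_bundle)
  }
qed

end
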